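(* Let $n\ge3$, let $\mathbf w=(1,-r_2,\dots,-r_n)$ with integers $r_i\ge0$, and let $m=\sum_{i\ge2}r_i$. Consider graded maps with source and target weights $\mathbf w$, that is, maps $$G=\bigl(x\Lambda,\;x^{-r_2}B_2,\dots,x^{-r_n}B_n\bigr)\colon\mathbb{C}^n\to\mathbb{C}^n,\qquad \Lambda\in\mathbb{C}[u],\ B_j\in V_j,\quad u_i=x^{r_i}y_i,$$ and put $P_j=B_j\Lambda^{r_j}$ and $\overline G=(P_2,\dots,P_n)\colon\mathbb{A}^{n-1}\to\mathbb{A}^{n-1}$. (i) If $m\ge2$, then every such $G$ with $\mu(B_2,\dots,B_n,\Lambda)=\kappa$ for some $\kappa\in\mathbb{C}^\times$ and with $\Lambda\notin\mathbb{C}$ is a counterexample to the Jacobian Conjecture; and the family of graded Keller counterexamples of this weight type, that is of graded Keller maps with source and target weights $\mathbf w$ which are not polynomial automorphisms, with degrees bounded by $\mathbf d=(d_2,\dots,d_n,d_\Lambda)$ (meaning $\deg B_i\le d_i$, $\deg\Lambda\le d_\Lambda$), is parametrised by the scheme $\mathcal{Y}^\circ_{\mathbf r,\mathbf d}$. (ii) If $m=1$, that is if $\mathbf w=(1,-1,0,\dots,0)$, then the exponent $m-1$ in the formula $\det JG=\pm\mathrm{Jac}_u(P_2,\dots,P_n)/\Lambda^{m-1}$ vanishes, $\det JG=\pm\mathrm{Jac}_u(P_2,\dots,P_n)$, and the Keller condition for $G$ is exactly the Keller condition for $\overline G$ in dimension $n-1$, with no contracted locus, as for Vasyunin's map.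
   Context: Coordinates on the source are $x,y_2,\dots,y_n$, with weights $1,-r_2,\dots,-r_n$; a map is graded with source and target weights $\mathbf w$ if its $j$-th component is weight-homogeneous of weight equal to the $j$-th entry of $\mathbf w$. Write $\mathbf r=(r_2,\dots,r_n)$, $u=(u_2,\dots,u_n)$, and $V_j=\mathrm{span}_{\mathbb{C}}\{u_2^{b_2}\cdots u_n^{b_n}:\sum_i r_ib_i\ge r_j\}$ (so $V_j=\mathbb{C}[u]$ when $r_j=0$). $JG$ is the Jacobian matrix of $G$, $\mathrm{Jac}_u(f_2,\dots,f_n)=\det(\partial f_i/\partial u_j)$, and $$\mu(B_2,\dots,B_n,\Lambda)=\Lambda\,\mathrm{Jac}_u(B_2,\dots,B_n)+\sum_{i=2}^nr_iB_i\,\mathrm{Jac}_u(B_2,\dots,\Lambda,\dots,B_n),$$ the $i$-th summand having $\Lambda$ in the slot of $B_i$. A Keller map is a polynomial self-map of affine space whose Jacobian determinant is a nonzero constant; a counterexample to the Jacobian Conjecture is a Keller map which is not a polynomial automorphism. The contracted locus is $\{\Lambda=0\}\subset\mathbb{A}^{n-1}_u$, along which the Keller condition $\mathrm{Jac}_u(P_2,\dots,P_n)=\kappa\Lambda^{m-1}$ prescribes the vanishing of the Jacobian of $\overline G$. Writing $\mu=\sum_{\mathbf b}\mu_{\mathbf b}u^{\mathbf b}$, $|\mathbf b|=\sum_i b_i$ and $D=d_\Lambda+\sum_{i\ge2}d_i-(n-1)$, the scheme $\mathcal{Y}^\circ_{\mathbf r,\mathbf d}$, defined over $\mathbb{Z}$,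 is the locally closed subscheme of $\mathbb{P}(V_2\cap\mathbb{C}[u]_{\le d_2})\times\dots\times\mathbb{P}(V_n\cap\mathbb{C}[u]_{\le d_n})\times\mathbb{P}(\mathbb{C}[u]_{\le d_\Lambda})$ given by $\mu_{\mathbf b}=0$ for $1\le|\mathbf b|\le D$, $\mu_{\mathbf 0}\ne0$ and $\deg\Lambda\ge1$, where $\mathbb{C}[u]_{\le d}$ is the space of polynomials of total degree at most $d$; its points are tuples $(B_2,\dots,B_n,\Lambda)$ up to independent nonzero scalings of the entries. Vasyunin's map is $X+H$ on $\mathbb{C}^5$ with $H=(0,\;X_1X_3,\;X_1X_4+\tfrac12X_2^2,\;X_1X_5-X_2X_3,\;\tfrac12X_3^2)$, graded with source and target weights $(1,-1,-2,-3,-4)$; it is a Keller map, has $\Lambda=1$, and is a polynomial automorphism.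
   Formalization: In (i) the parametrised family is restricted to maps with Λ not constant (constant-Λ counterexamples exist, e.g. n=4, r=(1,1,1), and are not points of the scheme); in (ii) "no contracted locus" means no point of {Λ=0} where Jac_u(P) vanishes, since {Λ=0} itself can be nonempty. *)

theory Defs
  imports "HOL-Analysis.Analysis" "HOL-Library.Poly_Mapping"
begin

text \<open>
  A polynomial with variables indexed by \<open>'v\<close> is a finitely supported map from exponent vectors
  to coefficients; the ring structure is the convolution product of \<^theory>\<open>HOL-Library.Poly_Mapping\<close>.
\<close>

type_synonym 'v monom = "'v \<Rightarrow>\<^sub>0 nat"
type_synonym ('v, 'a) mpoly = "'v monom \<Rightarrow>\<^sub>0 'a"

definition Cst :: "'a::zero \<Rightarrow> ('v, 'a) mpoly" where
  "Cst c = Poly_Mapping.single 0 c"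

definition Var :: "'v \<Rightarrow> ('v, 'a::zero_neq_one) mpoly" where
  "Var v = Poly_Mapping.single (Poly_Mapping.single v 1) 1"

definition coeff :: "('v, 'a::zero) mpoly \<Rightarrow> 'v monom \<Rightarrow> 'a" where
  "coeff p b = Poly_Mapping.lookup p b"

definition mdeg :: "'v::finite monom \<Rightarrow> nat" where
  "mdeg b = (\<Sum>v\<in>UNIV. Poly_Mapping.lookup b v)"

text \<open>Total degree, with the convention that the zero polynomial has degree \<open>0\<close>.\<close>

definition total_degree :: "('v::finite, 'a::zero) mpoly \<Rightarrow> nat" where
  "total_degree p = Max (insert 0 (mdeg ` Poly_Mapping.keys p))"

text \<open>Value of \<open>p\<close> when each variable \<open>v\<close> is replaced by \<open>f v\<close> and each coefficient \<open>c\<close> by \<open>h c\<close>.\<close>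

definition insertion ::
  "('a::zero \<Rightarrow> 'b) \<Rightarrow> ('v \<Rightarrow> 'b) \<Rightarrow> ('v, 'a) mpoly \<Rightarrow> 'b::comm_semiring_1" where
  "insertion h f p =
     (\<Sum>b\<in>Poly_Mapping.keys p.
        h (coeff p b) * (\<Prod>v\<in>Poly_Mapping.keys b. f v ^ Poly_Mapping.lookup b v))"

definition peval :: "('v \<Rightarrow> 'a) \<Rightarrow> ('v, 'a::comm_semiring_1) mpoly \<Rightarrow> 'a" where
  "peval a = insertion (\<lambda>c. c) a"

definition psubst ::
  "('v \<Rightarrow> ('w, 'a) mpoly) \<Rightarrow> ('v, 'a::comm_semiring_1) mpoly \<Rightarrow> ('w, 'a) mpoly" where
  "psubst f = insertion Cst f"

definition partial_deriv :: "'v \<Rightarrow> ('v, 'a::comm_semiring_1) mpoly \<Rightarrow> ('v, 'a) mpoly" where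
  "partial_deriv v p =
     (\<Sum>b\<in>Poly_Mapping.keys p.
        Poly_Mapping.single (b - Poly_Mapping.single v 1)
          (of_nat (Poly_Mapping.lookup b v) * coeff p b))"

type_synonym ('v, 'a) pmap = "'v \<Rightarrow> ('v, 'a) mpoly"

text \<open>
  The Jacobian determinant. Rows and columns carry the same index type, so no ordering
  of the variables is needed to fix its sign.
\<close>

definition jac :: "('v::finite, 'a::comm_ring_1) pmap \<Rightarrow> ('v, 'a) mpoly" where
  "jac F = det (\<chi> i j. partial_deriv j (F i))"

definition keller :: "('v::finite, complex) pmap \<Rightarrow> bool" where
  "keller F \<longleftrightarrow> (\<exists>\<kappa>. \<kappa> \<noteq> 0 \<and> jac F = Cst \<kappa>)"

definition poly_automorphism :: "('v, complex) pmap \<Rightarrow> bool" where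
  "poly_automorphism F \<longleftrightarrow>
     (\<exists>H :: ('v, complex) pmap. (\<forall>v. psubst H (F v) = Var v) \<and> (\<forall>v. psubst F (H v) = Var v))"

definition jc_counterexample :: "('v::finite, complex) pmap \<Rightarrow> bool" where
  "jc_counterexample F \<longleftrightarrow> keller F \<and> \<not> poly_automorphism F"

definition weighted_homogeneous ::
  "('v::finite \<Rightarrow> int) \<Rightarrow> int \<Rightarrow> ('v, 'a::zero) mpoly \<Rightarrow> bool" where
  "weighted_homogeneous w k p \<longleftrightarrow>
     (\<forall>b\<in>Poly_Mapping.keys p. (\<Sum>v\<in>UNIV. w v * int (Poly_Mapping.lookup b v)) = k)"

definition graded_map ::
  "('v::finite \<Rightarrow> int) \<Rightarrow> ('v \<Rightarrow> int) \<Rightarrow> ('v, 'a::zero) pmap \<Rightarrow> bool" where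
  "graded_map w w' F \<longleftrightarrow> (\<forall>v. weighted_homogeneous w (w' v) (F v))"

text \<open>
  The finite type \<open>'n\<close> plays the role of the index set \<open>{2, \<dots>, n}\<close>, so \<open>n = CARD('n) + 1\<close>.
  The source coordinates are indexed by \<open>'n option\<close>: \<open>None\<close> stands for \<open>x\<close> and \<open>Some i\<close> for \<open>y\<^sub>i\<close>.
  Polynomials in \<open>u = (u\<^sub>2, \<dots>, u\<^sub>n)\<close> have variables indexed by \<open>'n\<close>.
\<close>

definition weight :: "('n \<Rightarrow> nat) \<Rightarrow> 'n option \<Rightarrow> int" where
  "weight r v = (case v of None \<Rightarrow> 1 | Some i \<Rightarrow> - int (r i))"

definition rdeg :: "('n::finite \<Rightarrow> nat) \<Rightarrow> 'n monom \<Rightarrow> nat" where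
  "rdeg r b = (\<Sum>i\<in>UNIV. r i * Poly_Mapping.lookup b i)"

definition V :: "('n::finite \<Rightarrow> nat) \<Rightarrow> 'n \<Rightarrow> ('n, 'a::zero) mpoly set" where
  "V r j = {p. \<forall>b\<in>Poly_Mapping.keys p. rdeg r b \<ge> r j}"

definition uvar :: "('n \<Rightarrow> nat) \<Rightarrow> 'n \<Rightarrow> ('n option, 'a::comm_semiring_1) mpoly" where
  "uvar r i = Var None ^ r i * Var (Some i)"

text \<open>
  \<open>G = (x\<Lambda>, x\<^sup>-\<^sup>r\<^sup>2 B\<^sub>2, \<dots>, x\<^sup>-\<^sup>r\<^sup>n B\<^sub>n)\<close> with \<open>u\<^sub>i = x\<^sup>r\<^sup>i y\<^sub>i\<close>; the equation
  \<open>G\<^sub>j = x\<^sup>-\<^sup>r\<^sup>j B\<^sub>j\<close> between polynomials is written without negative powers.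
\<close>

definition graded_form ::
  "('n::finite \<Rightarrow> nat) \<Rightarrow> ('n option, complex) pmap \<Rightarrow>
   ('n, complex) mpoly \<Rightarrow> ('n, complex) pmap \<Rightarrow> bool" where
  "graded_form r G \<Lambda> B \<longleftrightarrow>
     (\<forall>j. B j \<in> V r j) \<and>
     G None = Var None * psubst (uvar r) \<Lambda> \<and>
     (\<forall>j. Var None ^ r j * G (Some j) = psubst (uvar r) (B j))"

definition Gbar ::
  "('n \<Rightarrow> nat) \<Rightarrow> ('n, complex) mpoly \<Rightarrow> ('n, complex) pmap \<Rightarrow> ('n, complex) pmap" where
  "Gbar r \<Lambda> B = (\<lambda>j. B j * \<Lambda> ^ r j)"

definition mu ::
  "('n::finite \<Rightarrow> nat) \<Rightarrow> ('n, 'a::comm_ring_1) pmap \<Rightarrow> ('n, 'a) mpoly \<Rightarrow> ('n, 'a) mpoly" where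
  "mu r B \<Lambda> = \<Lambda> * jac B + (\<Sum>i\<in>UNIV. of_nat (r i) * B i * jac (B(i := \<Lambda>)))"

definition contracted_locus :: "('n, complex) mpoly \<Rightarrow> ('n \<Rightarrow> complex) set" where
  "contracted_locus \<Lambda> = {a. peval a \<Lambda> = 0}"

text \<open>
  The ambient product of projective spaces has multihomogeneous coordinates indexed by pairs
  \<open>(k, b)\<close> with \<open>b \<in> exps r d d\<Lambda> k\<close>: \<open>(Some j, b)\<close> is the coefficient of \<open>u\<^sup>b\<close> in \<open>B\<^sub>j\<close> and
  \<open>(None, b)\<close> the coefficient of \<open>u\<^sup>b\<close> in \<open>\<Lambda>\<close>. Substituting the generic polynomials with these
  coordinates as coefficients into \<open>mu\<close> gives a polynomial in \<open>u\<close> whose coefficients \<open>\<mu>\<^sub>b\<close> are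
  integer polynomials in the coordinates, homogeneous of degree one in each group.
\<close>

type_synonym 'n coord = "'n option \<times> 'n monom"

definition exps :: "('n::finite \<Rightarrow> nat) \<Rightarrow> ('n \<Rightarrow> nat) \<Rightarrow> nat \<Rightarrow> 'n option \<Rightarrow> 'n monom set" where
  "exps r d d\<Lambda> k = (case k of None \<Rightarrow> {b. mdeg b \<le> d\<Lambda>}
                            | Some j \<Rightarrow> {b. mdeg b \<le> d j \<and> rdeg r b \<ge> r j})"

definition generic_poly ::
  "('n::finite \<Rightarrow> nat) \<Rightarrow> ('n \<Rightarrow> nat) \<Rightarrow> nat \<Rightarrow> 'n option \<Rightarrow> ('n, ('n coord, int) mpoly) mpoly" where
  "generic_poly r d d\<Lambda> k = (\<Sum>b\<in>exps r d d\<Lambda> k. Poly_Mapping.single b (Var (k, b)))"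

definition generic_mu ::
  "('n::finite \<Rightarrow> nat) \<Rightarrow> ('n \<Rightarrow> nat) \<Rightarrow> nat \<Rightarrow> 'n monom \<Rightarrow> ('n coord, int) mpoly" where
  "generic_mu r d d\<Lambda> b =
     coeff (mu r (\<lambda>j. generic_poly r d d\<Lambda> (Some j)) (generic_poly r d d\<Lambda> None)) b"

text \<open>The number \<open>D = d\<Lambda> + \<Sum>\<^sub>i d\<^sub>i - (n - 1)\<close> may be negative.\<close>

definition deg_bound :: "('n::finite \<Rightarrow> nat) \<Rightarrow> nat \<Rightarrow> int" where
  "deg_bound d d\<Lambda> = int d\<Lambda> + (\<Sum>i\<in>UNIV. int (d i)) - int CARD('n)"

definition Y_equations ::
  "('n::finite \<Rightarrow> nat) \<Rightarrow> ('n \<Rightarrow> nat) \<Rightarrow> nat \<Rightarrow> ('n coord, int) mpoly set" where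
  "Y_equations r d d\<Lambda> =
     {generic_mu r d d\<Lambda> b | b. 1 \<le> mdeg b \<and> int (mdeg b) \<le> deg_bound d d\<Lambda>}"

definition line :: "('n, 'a::field) mpoly \<Rightarrow> ('n, 'a) mpoly set" where
  "line p = {Cst c * p | c. c \<noteq> 0}"

definition proj_space :: "('n, 'a::field) mpoly set \<Rightarrow> ('n, 'a) mpoly set set" where
  "proj_space W = line ` (W - {0})"

definition coords :: "('n, 'a::zero) pmap \<Rightarrow> ('n, 'a) mpoly \<Rightarrow> 'n coord \<Rightarrow> 'a" where
  "coords B \<Lambda> = (\<lambda>(k, b). case k of None \<Rightarrow> coeff \<Lambda> b | Some j \<Rightarrow> coeff (B j) b)"

text \<open>
  The points of \<open>\<Y>\<degree>\<close> with values in a field. Because the equations are multihomogeneous, the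
  conditions do not depend on the chosen representatives \<open>B\<close>, \<open>\<Lambda>\<close>.
\<close>

definition Y_points ::
  "('n::finite \<Rightarrow> nat) \<Rightarrow> ('n \<Rightarrow> nat) \<Rightarrow> nat \<Rightarrow>
   (('n \<Rightarrow> ('n, 'a::field) mpoly set) \<times> ('n, 'a) mpoly set) set" where
  "Y_points r d d\<Lambda> =
     {(L, M).
        (\<forall>j. L j \<in> proj_space {p \<in> V r j. total_degree p \<le> d j}) \<and>
        M \<in> proj_space {p. total_degree p \<le> d\<Lambda>} \<and>
        (\<forall>B \<Lambda>. (\<forall>j. B j \<in> L j) \<and> \<Lambda> \<in> M \<longrightarrow>
           (\<forall>e\<in>Y_equations r d d\<Lambda>. insertion of_int (coords B \<Lambda>) e = 0) \<and>
           insertion of_int (coords B \<Lambda>) (generic_mu r d d\<Lambda> 0) \<noteq> 0 \<and>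
           total_degree \<Lambda> \<ge> 1)}"

definition graded_counterexamples ::
  "('n::finite \<Rightarrow> nat) \<Rightarrow> ('n \<Rightarrow> nat) \<Rightarrow> nat \<Rightarrow> ('n option, complex) pmap set" where
  "graded_counterexamples r d d\<Lambda> =
     {G. graded_map (weight r) (weight r) G \<and> jc_counterexample G \<and>
         (\<exists>\<Lambda> B. graded_form r G \<Lambda> B \<and> total_degree \<Lambda> \<le> d\<Lambda> \<and> (\<forall>j. total_degree (B j) \<le> d j))}"

text \<open>
  The members of the family with \<open>\<Lambda> \<notin> \<complex>\<close>; since \<open>\<Y>\<degree>\<close> requires \<open>deg \<Lambda> \<ge> 1\<close>, only these can
  correspond to its points. Members with \<open>\<Lambda> \<in> \<complex>\<close> are not excluded by the other conditions:
  for \<open>r = (1, \<dots>, 1)\<close> and any counterexample \<open>F\<close> in dimension \<open>n - 1\<close> with \<open>F(0) = 0\<close>, the map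
  \<open>(x, x\<^sup>-\<^sup>1 F(xy))\<close> is graded and a counterexample, with \<open>\<Lambda> = 1\<close>. So dropping \<open>\<Lambda> \<notin> \<complex>\<close> from the
  parametrisation would assert the Jacobian Conjecture in dimension \<open>n - 1\<close>.
\<close>

definition nonconst_graded_counterexamples ::
  "('n::finite \<Rightarrow> nat) \<Rightarrow> ('n \<Rightarrow> nat) \<Rightarrow> nat \<Rightarrow> ('n option, complex) pmap set" where
  "nonconst_graded_counterexamples r d d\<Lambda> =
     {G \<in> graded_counterexamples r d d\<Lambda>. \<exists>\<Lambda> B. graded_form r G \<Lambda> B \<and> \<Lambda> \<notin> range Cst}"

definition rescaling :: "(('v, complex) pmap \<times> ('v, complex) pmap) set" where
  "rescaling = {(G, G'). \<forall>v. \<exists>c. c \<noteq> 0 \<and> G' v = Cst c * G v}"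

text \<open>On \<open>\<complex>\<^sup>5\<close>, with \<open>X\<^sub>1\<close> the variable \<open>None\<close> and \<open>X\<^sub>i\<^sub>+\<^sub>1\<close> the variable \<open>Some i\<close>, \<open>i = 1, \<dots>, 4\<close>.\<close>

definition vasyunin_r :: "4 \<Rightarrow> nat" where
  "vasyunin_r i = (if i = 1 then 1 else if i = 2 then 2 else if i = 3 then 3 else 4)"

definition vasyunin :: "(4 option, complex) pmap" where
  "vasyunin v =
     (let X1 = Var None; X2 = Var (Some 1); X3 = Var (Some 2); X4 = Var (Some 3); X5 = Var (Some 4)
      in Var v + (if v = None then 0
           else if v = Some 1 then X1 * X3
           else if v = Some 2 then X1 * X4 + Cst (1/2) * X2 ^ 2
           else if v = Some 3 then X1 * X5 - X2 * X3
           else Cst (1/2) * X3 ^ 2))"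

end

theory Submission
  imports Defs
begin

text \<open>
  Write \<open>\<phi>\<close> for the substitution \<open>u\<^sub>i = x\<^sup>r\<^sup>i y\<^sub>i\<close>. Setting \<open>x = 1\<close> inverts it, so a map of
  weights \<open>(1, -r\<^sub>2, \<dots>, -r\<^sub>n)\<close> is the same thing as the pair \<open>(\<Lambda>, B)\<close> of its restrictions to \<open>x = 1\<close>
  (\<open>graded_map_iff_ex1_graded_form\<close>), and identities between polynomials in \<open>u\<close> can be tested after
  applying \<open>\<phi>\<close>.

  The Jacobian determinants rest on two identities. Euler's identity for the weighted grading turns the
  \<open>x\<close>-column of the Jacobian matrix of \<open>G\<close> into the components of \<open>G\<close>, and the expansion along this
  column gives \<open>jac G = \<phi>(mu)\<close> (\<open>jac_graded_form\<close>). The matrix of \<open>Gbar\<close> is a rank one update, so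
  \<open>jac (Gbar) = mu \<cdot> \<Lambda>\<^sup>m\<^sup>-\<^sup>1\<close> (\<open>jac_Gbar\<close>). Comparing the two yields the formula for \<open>jac G\<close> with sign
  \<open>\<epsilon> = 1\<close>, and for \<open>m = 1\<close> the equivalence of the two Keller conditions. It also shows that \<open>G\<close> is a
  Keller map if and only if \<open>mu\<close> is a nonzero constant.

  A graded map with nonconstant \<open>\<Lambda>\<close> is never an automorphism: its first component \<open>x\<phi>(\<Lambda>)\<close> is a product
  of nonconstant polynomials, whereas an automorphism takes the irreducible variable \<open>x\<close> to an
  irreducible polynomial (\<open>graded_form_not_automorphism\<close>).

  For the parametrisation, \<open>mu\<close> has degree at most \<open>deg_bound\<close>, so being a nonzero constant is a
  condition on finitely many coefficients, and these are specialisations of the generic integral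
  ones (\<open>insertion_generic_mu\<close>). As \<open>mu\<close> is linear in each argument, the condition passes to lines, and
  rescaling the components of \<open>G\<close> corresponds to changing representatives of the lines
  (\<open>rescaling_iff_lines\<close>). Vasyunin's map is settled by computing its pair, with \<open>\<Lambda> = 1\<close>.
\<close>

section \<open>Determinants over an index set with one extra element\<close>

text \<open>
  Laplace expansion along the column of the additional index. The \<open>k\<close>-th minor is written by
  putting the row \<open>None\<close> in the place of row \<open>k\<close>, so that every such term has the sign of a
  transposition. This is exactly the shape of \<open>mu\<close>, where \<open>\<Lambda>\<close> takes the slot of \<open>B\<^sub>i\<close>.
\<close>

lemma det_expand_column_None:
  fixes A :: "'a::comm_ring_1 ^ 'n::finite option ^ 'n option"
  shows "det A = A $ None $ None * det (\<chi> i j. A $ Some i $ Some j)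
           - (\<Sum>k\<in>UNIV. A $ Some k $ None *
                det (\<chi> i j. A $ (if i = k then None else Some i) $ Some j))"
proof -
  let ?S = "range (Some :: 'n \<Rightarrow> 'n option)"
  let ?f = "\<lambda>p. of_int (sign p) * (\<Prod>i\<in>UNIV. A $ p i $ i)"
  let ?d = "\<lambda>b. det (\<chi> i j. A $ (Transposition.transpose None b (Some i)) $ Some j)"
  \<comment> \<open>Permutations of the old indices are the permutations of \<open>range Some\<close>.\<close>
  have "bij_betw Some (UNIV :: 'n set) ?S"
    by (simp add: bij_betw_def)
  moreover have "(\<lambda>x. if x \<in> ?S then Some (q (inv Some x)) else x) = map_option q" for q :: "'n \<Rightarrow> 'n"
    by (auto simp: fun_eq_iff map_option_case split: option.split)
  ultimately have bij: "bij_betw map_option {q. q permutes (UNIV::'n set)} {p. p permutes ?S}"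
    using bij_betw_permutations[of Some UNIV ?S] by simp
  have mp: "map_permutation UNIV Some q = map_option q" for q :: "'n \<Rightarrow> 'n"
    by (auto simp: fun_eq_iff map_permutation_def restrict_id_def map_option_case split: option.split)
  have term_eq: "(\<Sum>q | q permutes ?S. ?f (Transposition.transpose None b \<circ> q))
      = (if b = None then 1 else - 1) * A $ b $ None * ?d b" for b
  proof -
    have "?f (Transposition.transpose None b \<circ> map_option q) = (if b = None then 1 else - 1) * A $ b $ None *
        (of_int (sign q) * (\<Prod>j\<in>UNIV. A $ Transposition.transpose None b (Some (q j)) $ Some j))"
      if q: "q permutes (UNIV::'n set)" for q
    proof -
      have q': "map_option q permutes ?S"
        using bij q by (auto simp: bij_betw_def)
      then have pq: "permutation (map_option q)" by (metis finite permutation_permutes finite_imageI)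
      have "sign (map_option q) = sign q"
        using sign_map_permutation[of Some UNIV q] q by (simp add: mp)
      then have "sign (Transposition.transpose None b \<circ> map_option q) = (if b = None then 1 else - 1) * sign q"
        by (simp add: sign_compose[OF permutation_swap_id pq] sign_swap_id)
      then show ?thesis
        by (simp add: UNIV_option_conv prod.reindex algebra_simps)
    qed
    then have "(\<Sum>q | q permutes (UNIV::'n set). ?f (Transposition.transpose None b \<circ> map_option q)) =
       (if b = None then 1 else - 1) * A $ b $ None *
        (\<Sum>q | q permutes UNIV. of_int (sign q) * (\<Prod>j\<in>UNIV. A $ Transposition.transpose None b (Some (q j)) $ Some j))"
      by (simp add: sum_distrib_left)
    also have "(\<Sum>q | q permutes UNIV. of_int (sign q) * (\<Prod>j\<in>UNIV. A $ Transposition.transpose None b (Some (q j)) $ Some j)) = ?d b"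
      by (subst det_transpose[symmetric]) (simp add: det_def transpose_def)
    finally show ?thesis
      unfolding sum.reindex_bij_betw[OF bij, of "\<lambda>q. ?f (Transposition.transpose None b \<circ> q)"] .
  qed
  have rows: "(\<chi> i j. A $ (Transposition.transpose None (Some k) (Some i)) $ Some j)
      = (\<chi> i j. A $ (if i = k then None else Some i) $ Some j)" for k
    by (simp add: vec_eq_iff Transposition.transpose_def)
  have "det A = det (transpose A)" by simp
  also have "\<dots> = sum ?f {p. p permutes insert None ?S}"
    by (simp add: det_def transpose_def UNIV_option_conv)
  also have "\<dots> = (\<Sum>b\<in>insert None ?S. (if b = None then 1 else - 1) * A $ b $ None * ?d b)"
    by (subst sum_over_permutations_insert) (simp, simp, simp only: term_eq)
  also have "\<dots> = A $ None $ None * ?d None - (\<Sum>k\<in>UNIV. A $ Some k $ None * ?d (Some k))"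
    by (simp add: sum.reindex sum_negf)
  finally show ?thesis by (simp add: rows)
qed


lemma det_zero_row_ring:
  fixes A :: "'a::comm_ring_1 ^ 'n::finite ^ 'n"
  assumes "\<And>j. A $ i $ j = 0"
  shows "det A = 0"
proof -
  have "(\<Prod>k\<in>UNIV. A $ k $ p k) = 0" for p :: "'n \<Rightarrow> 'n"
    using assms[of "p i"] by (subst prod.remove[of _ i]) auto
  then show ?thesis by (simp add: det_def)
qed

lemma det_scale_rows:
  fixes M :: "'n::finite \<Rightarrow> 'n \<Rightarrow> 'a::comm_ring_1"
  shows "det (\<chi> i j. c i * M i j) = (\<Prod>i\<in>UNIV. c i) * det (\<chi> i j. M i j)"
proof -
  have "(\<chi> i j. c i * M i j) = (\<chi> i. c i *s (\<chi> j. M i j))"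
    by (simp add: vec_eq_iff)
  then show ?thesis by (simp add: det_rows_mul)
qed

lemma det_scale_columns:
  fixes M :: "'n::finite \<Rightarrow> 'n \<Rightarrow> 'a::comm_ring_1"
  shows "det (\<chi> i j. c j * M i j) = (\<Prod>j\<in>UNIV. c j) * det (\<chi> i j. M i j)"
proof -
  have "det (\<chi> i j. c j * M i j) = det (\<chi> j i. c j * M i j)"
    by (subst det_transpose[symmetric]) (simp add: transpose_def)
  also have "\<dots> = (\<Prod>j\<in>UNIV. c j) * det (\<chi> j i. M i j)"
    by (rule det_scale_rows)
  also have "det (\<chi> j i. M i j) = det (\<chi> i j. M i j)"
    by (subst det_transpose[symmetric]) (simp add: transpose_def)
  finally show ?thesis .
qed

text \<open>
  Right multiplication by this matrix replaces the column \<open>None\<close> by \<open>a\<close> times itself plus the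
  combination of the other columns with coefficients \<open>t\<close>.
\<close>

definition column_operation :: "'a::comm_ring_1 \<Rightarrow> ('n \<Rightarrow> 'a) \<Rightarrow> 'a ^ 'n::finite option ^ 'n option" where
  "column_operation a t =
     (\<chi> k l. case (k, l) of (None, None) \<Rightarrow> a | (Some i, None) \<Rightarrow> t i
        | (None, Some j) \<Rightarrow> 0 | (Some i, Some j) \<Rightarrow> if i = j then 1 else 0)"

lemma sum_UNIV_option:
  fixes f :: "'n::finite option \<Rightarrow> 'a::comm_monoid_add"
  shows "sum f UNIV = f None + (\<Sum>i\<in>UNIV. f (Some i))"
  by (simp add: UNIV_option_conv sum.reindex)

lemma prod_UNIV_option:
  fixes f :: "'n::finite option \<Rightarrow> 'a::comm_monoid_mult"
  shows "prod f UNIV = f None * (\<Prod>i\<in>UNIV. f (Some i))"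
  by (simp add: UNIV_option_conv prod.reindex)

lemma det_column_operation: "det (column_operation a t) = a"
proof -
  have "det (\<chi> i j. column_operation a t $ (if i = k then None else Some i) $ Some j) = 0" for k
    by (rule det_zero_row_ring[of _ k]) (simp add: column_operation_def)
  moreover have "(\<chi> i j. column_operation a t $ Some i $ Some j) = mat 1"
    by (simp add: column_operation_def mat_def vec_eq_iff)
  ultimately show ?thesis
    by (simp add: det_expand_column_None) (simp add: column_operation_def)
qed

lemma times_column_operation:
  "(A ** column_operation a t) $ i $ None = A $ i $ None * a + (\<Sum>k\<in>UNIV. A $ i $ Some k * t k)"
  "(A ** column_operation a t) $ i $ Some j = A $ i $ Some j"
  by (simp_all add: matrix_matrix_mult_def sum_UNIV_option column_operation_def if_distrib cong: if_cong)

text \<open>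
  The matrix determinant lemma without inverses: clearing the column of the bordered matrix with
  rows \<open>(1, v)\<close> and \<open>(- c\<^sub>i, M\<^sub>i)\<close> adds \<open>c\<^sub>i v\<close> to row \<open>i\<close>, and the determinant of the bordered matrix
  can be expanded before or after this row operation.
\<close>

lemma det_rank_one_update:
  fixes M :: "'n::finite \<Rightarrow> 'n \<Rightarrow> 'a::comm_ring_1"
  shows "det (\<chi> i j. M i j + c i * v j) =
    det (\<chi> i j. M i j) + (\<Sum>k\<in>UNIV. c k * det (\<chi> i j. if i = k then v j else M i j))"
proof -
  define A :: "'a ^ 'n option ^ 'n option" where
    "A = (\<chi> k l. case (k, l) of (None, None) \<Rightarrow> 1 | (Some i, None) \<Rightarrow> - c i
        | (None, Some j) \<Rightarrow> v j | (Some i, Some j) \<Rightarrow> M i j)"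
  have dL: "det (column_operation 1 c) = 1" by (rule det_column_operation)
  define B where "B = (\<chi> k l. case k of None \<Rightarrow> A $ None $ l | Some i \<Rightarrow> A $ Some i $ l + c i * A $ None $ l)"
  have AB: "column_operation 1 c ** A = B"
    by (simp add: vec_eq_iff matrix_matrix_mult_def column_operation_def B_def sum_UNIV_option
        if_distribR algebra_simps if_distrib split: option.split cong: if_cong)
  have "det A = det B"
    using det_mul[of "column_operation 1 c" A] by (simp add: AB dL)
  moreover have "det A = det (\<chi> i j. M i j) + (\<Sum>k\<in>UNIV. c k * det (\<chi> i j. if i = k then v j else M i j))"
  proof -
    have "(\<chi> i j. A $ (if i = k then None else Some i) $ Some j) = (\<chi> i j. if i = k then v j else M i j)" for k
      by (simp add: vec_eq_iff A_def)
    then show ?thesis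
      by (simp add: det_expand_column_None) (simp add: A_def sum_negf)
  qed
  moreover have "det B = det (\<chi> i j. M i j + c i * v j)"
    by (simp add: det_expand_column_None) (simp add: A_def B_def)
  ultimately show ?thesis by simp
qed

lemma det_4:
  "det (A::'a::comm_ring_1^4^4) =
    A$1$1 * (A$2$2 * (A$3$3 * A$4$4 - A$3$4 * A$4$3) - A$2$3 * (A$3$2 * A$4$4 - A$3$4 * A$4$2) + A$2$4 * (A$3$2 * A$4$3 - A$3$3 * A$4$2))
  - A$1$2 * (A$2$1 * (A$3$3 * A$4$4 - A$3$4 * A$4$3) - A$2$3 * (A$3$1 * A$4$4 - A$3$4 * A$4$1) + A$2$4 * (A$3$1 * A$4$3 - A$3$3 * A$4$1))
  + A$1$3 * (A$2$1 * (A$3$2 * A$4$4 - A$3$4 * A$4$2) - A$2$2 * (A$3$1 * A$4$4 - A$3$4 * A$4$1) + A$2$4 * (A$3$1 * A$4$2 - A$3$2 * A$4$1))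
  - A$1$4 * (A$2$1 * (A$3$2 * A$4$3 - A$3$3 * A$4$2) - A$2$2 * (A$3$1 * A$4$3 - A$3$3 * A$4$1) + A$2$3 * (A$3$1 * A$4$2 - A$3$2 * A$4$1))"
proof -
  have f1: "finite {2::4, 3, 4}" "1 \<notin> {2::4, 3, 4}" by auto
  have f2: "finite {3::4, 4}" "2 \<notin> {3::4, 4}" by auto
  have f3: "finite {4::4}" "3 \<notin> {4::4}" by auto
  show ?thesis
    unfolding det_def UNIV_4
    unfolding sum_over_permutations_insert[OF f1]
    unfolding sum_over_permutations_insert[OF f2]
    unfolding sum_over_permutations_insert[OF f3]
    unfolding permutes_sing
    by (simp add: sign_swap_id permutation_swap_id permutation_compose sign_compose)
       (simp add: algebra_simps)
qed

section \<open>Polynomials and ring homomorphisms\<close>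

lemma poly_mapping_eq_sum_single:
  fixes p :: "'b \<Rightarrow>\<^sub>0 'a::comm_monoid_add"
  shows "p = (\<Sum>b\<in>Poly_Mapping.keys p. Poly_Mapping.single b (Poly_Mapping.lookup p b))"
  by (rule poly_mapping_eqI)
     (simp add: lookup_sum lookup_single when_def not_in_keys_iff_lookup_eq_zero)

abbreviation monomial :: "'v monom \<Rightarrow> 'a::zero \<Rightarrow> ('v, 'a) mpoly" where
  "monomial \<equiv> Poly_Mapping.single"

lemma monomial_add_induct [case_names monomial add]:
  fixes p :: "('v, 'a::comm_monoid_add) mpoly"
  assumes "\<And>b c. P (monomial b c)" and "\<And>p q. P p \<Longrightarrow> P q \<Longrightarrow> P (p + q)"
  shows "P p"
proof -
  have "P (\<Sum>b\<in>S. monomial b (Poly_Mapping.lookup p b))" if "finite S" for S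
    using that
  proof (induction S)
    case empty
    show ?case using assms(1)[of 0 0] by simp
  qed (simp add: assms)
  then show ?thesis by (subst poly_mapping_eq_sum_single) simp
qed

lemma Var_power_eq_monomial: "Var v ^ k = monomial (Poly_Mapping.single v k) (1::'a::comm_semiring_1)"
  by (induction k) (simp_all add: Var_def mult_single single_add[symmetric])

lemma monomial_1_eq_prod_Var:
  "monomial b (1::'a::comm_semiring_1) = (\<Prod>v\<in>Poly_Mapping.keys b. Var v ^ Poly_Mapping.lookup b v)"
proof -
  have "(\<Prod>v\<in>S. Var v ^ f v) = monomial (\<Sum>v\<in>S. Poly_Mapping.single v (f v)) (1::'a)"
    for S :: "'b set" and f
    by (induction S rule: infinite_finite_induct) (simp_all add: Var_power_eq_monomial mult_single)
  then show ?thesis by (metis poly_mapping_eq_sum_single)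
qed

lemma monomial_eq_Cst_mult: "monomial b c = Cst c * monomial b (1::'a::comm_semiring_1)"
  by (simp add: Cst_def mult_single)

lemma monomial_eq_prod_Var_UNIV:
  "monomial b (c::'a::comm_semiring_1) = Cst c * (\<Prod>v\<in>(UNIV::'v::finite set). Var v ^ Poly_Mapping.lookup b v)"
  unfolding monomial_eq_Cst_mult[of b c] monomial_1_eq_prod_Var
  by (rule arg_cong[of _ _ "\<lambda>x. _ * x"], rule prod.mono_neutral_left)
     (auto simp: not_in_keys_iff_lookup_eq_zero)

lemma Cst_simps [simp]:
  "Cst 0 = 0" "Cst (1::'a::zero_neq_one) = 1"
  by (simp_all add: Cst_def)

lemma Cst_add: "Cst (a + b) = Cst a + Cst (b::'a::monoid_add)"
  and Cst_mult: "Cst (c * d) = Cst c * Cst (d::'b::semiring_0)"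
  by (simp_all add: Cst_def single_add mult_single)

lemma Cst_eq_iff [simp]: "Cst a = Cst b \<longleftrightarrow> a = b"
  by (simp add: Cst_def) (metis lookup_single_eq)

lemma mpoly_induct [case_names Cst Var add mult]:
  fixes p :: "('v, 'a::comm_semiring_1) mpoly"
  assumes "\<And>c. P (Cst c)" and "\<And>v. P (Var v)"
    and "\<And>p q. P p \<Longrightarrow> P q \<Longrightarrow> P (p + q)" and "\<And>p q. P p \<Longrightarrow> P q \<Longrightarrow> P (p * q)"
  shows "P p"
proof (induction p rule: monomial_add_induct)
  case (monomial b c)
  have one: "P 1" using assms(1)[of 1] by simp
  have "P (Var v ^ k)" for v k
    by (induction k) (simp_all add: assms one)
  then have "P (\<Prod>v\<in>S. Var v ^ f v)" for S f
    by (induction S rule: infinite_finite_induct) (simp_all add: assms one)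
  then show ?case
    unfolding monomial_eq_Cst_mult[of b c] monomial_1_eq_prod_Var by (intro assms)
qed (rule assms)

lemma lookup_monomial_mult:
  "Poly_Mapping.lookup (monomial a (1::'a::comm_semiring_1) * p) (a + b) = Poly_Mapping.lookup p b"
  by (induction p rule: monomial_add_induct)
     (simp_all add: mult_single lookup_single distrib_left lookup_add when_def)

text \<open>
  Multiplication by a monomial shifts the exponents, hence loses nothing. This makes sense of the
  division by powers of \<open>x\<close> in \<open>G\<^sub>j = x\<^sup>-\<^sup>r\<^sup>j B\<^sub>j\<close>.
\<close>

lemma Var_power_cancel:
  fixes p q :: "('v, 'a::comm_semiring_1) mpoly"
  assumes "Var v ^ k * p = Var v ^ k * q"
  shows "p = q"
proof (rule poly_mapping_eqI)
  fix b
  show "Poly_Mapping.lookup p b = Poly_Mapping.lookup q b"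
    using lookup_monomial_mult[of "Poly_Mapping.single v k" p b]
      lookup_monomial_mult[of "Poly_Mapping.single v k" q b] assms
    by (simp add: Var_power_eq_monomial)
qed

text \<open>
  Evaluations, substitutions and changes of coefficients are all instances of \<open>insertion\<close>. They
  are ring homomorphisms, so two of them agree as soon as they agree on constants and variables.
\<close>

locale semiring_hom =
  fixes h :: "'a::comm_semiring_1 \<Rightarrow> 'b::comm_semiring_1"
  assumes hom_0 [simp]: "h 0 = 0" and hom_1 [simp]: "h 1 = 1"
    and hom_add: "h (x + y) = h x + h y" and hom_mult: "h (x * y) = h x * h y"
begin

lemma hom_sum: "h (sum f S) = (\<Sum>x\<in>S. h (f x))"
  by (induction S rule: infinite_finite_induct) (simp_all add: hom_add)

lemma hom_prod: "h (prod f S) = (\<Prod>x\<in>S. h (f x))"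
  by (induction S rule: infinite_finite_induct) (simp_all add: hom_mult)

lemma hom_power: "h (x ^ k) = h x ^ k"
  by (induction k) (simp_all add: hom_mult)

lemma hom_of_nat: "h (of_nat k) = of_nat k"
  by (induction k) (simp_all add: hom_add)

lemma insertion_0 [simp]: "insertion h f 0 = 0"
  by (simp add: insertion_def)

lemma insertion_monomial:
  "insertion h f (monomial b c) = h c * (\<Prod>v\<in>Poly_Mapping.keys b. f v ^ Poly_Mapping.lookup b v)"
  by (simp add: insertion_def coeff_def)

lemma insertion_Cst [simp]: "insertion h f (Cst c) = h c"
  by (simp add: Cst_def insertion_monomial)

lemma insertion_Var [simp]: "insertion h f (Var v) = f v"
  by (simp add: Var_def insertion_monomial)

lemma insertion_add: "insertion h f (p + q) = insertion h f p + insertion h f q"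
  unfolding insertion_def coeff_def
  by (rule setsum_keys_plus_distrib) (simp_all add: hom_add distrib_right)

lemma insertion_mult: "insertion h f (p * q) = insertion h f p * insertion h f q"
proof -
  define e where "e b = (\<Prod>v\<in>Poly_Mapping.keys b. f v ^ Poly_Mapping.lookup b v)" for b
  have e_superset: "e b = (\<Prod>v\<in>S. f v ^ Poly_Mapping.lookup b v)"
    if "Poly_Mapping.keys b \<subseteq> S" "finite S" for b S
    unfolding e_def by (rule prod.mono_neutral_left) (use that in \<open>auto simp: not_in_keys_iff_lookup_eq_zero\<close>)
  have e_add: "e (a + b) = e a * e b" for a b
  proof -
    let ?S = "Poly_Mapping.keys a \<union> Poly_Mapping.keys b"
    have "e (a + b) = (\<Prod>v\<in>?S. f v ^ Poly_Mapping.lookup (a + b) v)"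
      by (rule e_superset) (auto simp: keys_add)
    also have "\<dots> = (\<Prod>v\<in>?S. f v ^ Poly_Mapping.lookup a v) * (\<Prod>v\<in>?S. f v ^ Poly_Mapping.lookup b v)"
      by (simp add: lookup_add power_add prod.distrib)
    finally show ?thesis by (simp add: e_superset[of _ ?S])
  qed
  show ?thesis
  proof (induction p rule: monomial_add_induct)
    case (monomial a c)
    show ?case
      by (induction q rule: monomial_add_induct)
         (simp_all add: distrib_left insertion_add mult_single insertion_monomial hom_mult
           e_add flip: e_def, simp add: ac_simps)
  qed (simp add: distrib_right insertion_add)
qed

lemma semiring_hom_insertion: "semiring_hom (insertion h f)"
  using insertion_Cst[of f 1]
  by unfold_locales (simp_all add: insertion_add insertion_mult)

end

locale ring_hom = semiring_hom h for h :: "'a::comm_ring_1 \<Rightarrow> 'b::comm_ring_1"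
begin

lemma hom_uminus: "h (- x) = - h x"
  using hom_add[of x "- x"] by (simp add: eq_neg_iff_add_eq_0 add.commute)

lemma hom_of_int: "h (of_int k) = of_int k"
  by (cases k) (simp_all add: hom_uminus hom_of_nat del: of_nat_Suc)

lemma hom_det: "h (det A) = det (\<chi> i j. h (A $ i $ j))"
  by (simp add: det_def hom_sum hom_mult hom_of_int hom_prod)

lemma ring_hom_insertion: "ring_hom (insertion h f)"
  unfolding ring_hom_def by (rule semiring_hom_insertion)

end

text \<open>
  The universal property of the polynomial ring, uniqueness part.
\<close>

lemma hom_eqI:
  fixes h k :: "('v, 'a::comm_semiring_1) mpoly \<Rightarrow> 'b::comm_semiring_1"
  assumes "semiring_hom h" "semiring_hom k"
    and "\<And>c. h (Cst c) = k (Cst c)" and "\<And>v. h (Var v) = k (Var v)"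
  shows "h p = k p"
  by (induction p rule: mpoly_induct) (simp_all add: assms semiring_hom.hom_add semiring_hom.hom_mult)

lemma semiring_hom_comp:
  assumes "semiring_hom h" "semiring_hom k"
  shows "semiring_hom (\<lambda>x. h (k x))"
proof -
  interpret h: semiring_hom h by fact
  interpret k: semiring_hom k by fact
  show ?thesis by unfold_locales (simp_all add: h.hom_add k.hom_add h.hom_mult k.hom_mult)
qed

lemma semiring_hom_ident: "semiring_hom (\<lambda>x. x)"
  by unfold_locales simp_all

interpretation Cst: semiring_hom "Cst :: 'a::comm_semiring_1 \<Rightarrow> ('v, 'a) mpoly"
  by unfold_locales (simp_all add: Cst_add Cst_mult)

lemma semiring_hom_psubst: "semiring_hom (psubst f)"
  unfolding psubst_def by (rule Cst.semiring_hom_insertion)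

interpretation psubst: semiring_hom "psubst f :: ('v, 'a::comm_semiring_1) mpoly \<Rightarrow> ('w, 'a) mpoly"
  for f by (rule semiring_hom_psubst)

interpretation psubst: ring_hom "psubst f :: ('v, 'a::comm_ring_1) mpoly \<Rightarrow> ('w, 'a) mpoly"
  for f unfolding ring_hom_def by (rule semiring_hom_psubst)

lemma psubst_Cst [simp]: "psubst f (Cst c) = Cst c"
  and psubst_Var [simp]: "psubst f (Var v) = f v"
  by (simp_all add: psubst_def)

lemma psubst_psubst: "psubst f (psubst g p) = psubst (\<lambda>v. psubst f (g v)) p"
  by (rule hom_eqI) (simp_all add: semiring_hom_comp semiring_hom_psubst)

lemma psubst_ident: "psubst Var p = p"
  by (rule hom_eqI[of "psubst Var"]) (simp_all add: semiring_hom_psubst semiring_hom_ident)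

section \<open>Derivatives, degrees and weights\<close>

abbreviation unit_exp :: "'v \<Rightarrow> 'v monom" where
  "unit_exp v \<equiv> Poly_Mapping.single v 1"

lemma partial_deriv_0 [simp]: "partial_deriv v 0 = 0"
  by (simp add: partial_deriv_def)

lemma partial_deriv_monomial:
  "partial_deriv v (monomial b c) = monomial (b - unit_exp v) (of_nat (Poly_Mapping.lookup b v) * c)"
  by (simp add: partial_deriv_def coeff_def)

lemma partial_deriv_add: "partial_deriv v (p + q) = partial_deriv v p + partial_deriv v q"
  unfolding partial_deriv_def coeff_def
  by (rule setsum_keys_plus_distrib) (simp_all add: distrib_left single_add)

lemma partial_deriv_sum: "partial_deriv v (sum f S) = (\<Sum>x\<in>S. partial_deriv v (f x))"
  by (induction S rule: infinite_finite_induct) (simp_all add: partial_deriv_add)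

lemma minus_unit_exp_add:
  fixes a b :: "'v monom"
  assumes "Poly_Mapping.lookup a v \<noteq> 0"
  shows "a - unit_exp v + b = a + b - unit_exp v"
  by (rule poly_mapping_eqI) (use assms in \<open>auto simp: lookup_add lookup_minus lookup_single when_def\<close>)

lemma partial_deriv_mult:
  "partial_deriv v (p * q) = partial_deriv v p * q + p * partial_deriv v q"
proof (induction p rule: monomial_add_induct)
  case (monomial a c)
  show ?case
  proof (induction q rule: monomial_add_induct)
    case (monomial b d)
    have "monomial (a - unit_exp v + b) (of_nat (Poly_Mapping.lookup a v) * c * d)
        = monomial (a + b - unit_exp v) (of_nat (Poly_Mapping.lookup a v) * c * d)"
      using minus_unit_exp_add[of a v b] by (cases "Poly_Mapping.lookup a v = 0") auto
    moreover have "monomial (a + (b - unit_exp v)) (of_nat (Poly_Mapping.lookup b v) * d * c)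
        = monomial (a + b - unit_exp v) (of_nat (Poly_Mapping.lookup b v) * d * c)"
      using minus_unit_exp_add[of b v a] by (cases "Poly_Mapping.lookup b v = 0") (auto simp: add.commute)
    ultimately show ?case
      by (simp add: partial_deriv_monomial mult_single lookup_add single_add[symmetric] algebra_simps)
  qed (simp add: distrib_left distrib_right partial_deriv_add ac_simps)
qed (simp add: distrib_left distrib_right partial_deriv_add ac_simps)

lemma partial_deriv_Cst [simp]: "partial_deriv v (Cst c) = 0"
  by (simp add: Cst_def partial_deriv_monomial)

lemma partial_deriv_1 [simp]: "partial_deriv v 1 = 0"
  using partial_deriv_Cst[of v 1] by simp

lemma partial_deriv_Var: "partial_deriv v (Var w) = (if v = w then 1 else 0)"
  by (simp add: Var_def partial_deriv_monomial lookup_single)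

lemma partial_deriv_power:
  "partial_deriv v (p ^ k) = of_nat k * p ^ (k - 1) * partial_deriv v p"
proof (induction k)
  case (Suc k)
  then show ?case
    by (cases k) (simp_all add: partial_deriv_mult algebra_simps)
qed simp

lemma jac_scale: "jac (\<lambda>i. Cst (c i) * B i) = Cst (\<Prod>i\<in>UNIV. c i) * jac B"
  by (simp add: jac_def partial_deriv_mult det_scale_rows Cst.hom_prod)

text \<open>
  Each summand of \<open>mu\<close> is linear in every \<open>B\<^sub>i\<close> and in \<open>\<Lambda>\<close>. The scalars may be zero, which later
  shows that \<open>mu\<close> vanishes if one of its arguments does.
\<close>

lemma mu_scale:
  "mu r (\<lambda>i. Cst (c i) * B i) (Cst e * \<Lambda>) = Cst (e * (\<Prod>i\<in>UNIV. c i)) * mu r B \<Lambda>"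
proof -
  have upd: "(\<lambda>i. Cst (c i) * B i)(k := Cst e * \<Lambda>) = (\<lambda>i. Cst ((c(k := e)) i) * (B(k := \<Lambda>)) i)" for k
    by auto
  have "(\<Prod>i\<in>UNIV. (c(k := e)) i) = e * (\<Prod>i\<in>UNIV - {k}. c i)" for k
    by (subst prod.remove[of _ k]) (auto intro!: arg_cong2[where f = "(*)"] prod.cong)
  then have "c k * (\<Prod>i\<in>UNIV. (c(k := e)) i) = e * (\<Prod>i\<in>UNIV. c i)" for k
    by (simp add: prod.remove[of UNIV k c] ac_simps)
  then have "of_nat (r k) * (Cst (c k) * B k) * jac ((\<lambda>i. Cst (c i) * B i)(k := Cst e * \<Lambda>))
      = Cst (e * (\<Prod>i\<in>UNIV. c i)) * (of_nat (r k) * B k * jac (B(k := \<Lambda>)))" for k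
    unfolding upd jac_scale by (metis (no_types, opaque_lifting) Cst_mult mult.assoc mult.left_commute)
  moreover have "Cst e * \<Lambda> * jac (\<lambda>i. Cst (c i) * B i) = Cst (e * (\<Prod>i\<in>UNIV. c i)) * (\<Lambda> * jac B)"
    unfolding jac_scale by (simp add: Cst_mult ac_simps)
  ultimately show ?thesis
    unfolding mu_def distrib_left sum_distrib_left by simp
qed

lemma mu_hom:
  assumes "ring_hom h" "\<And>v p. h (partial_deriv v p) = partial_deriv v (h p)"
  shows "h (mu r B \<Lambda>) = mu r (\<lambda>i. h (B i)) (h \<Lambda>)"
proof -
  interpret ring_hom h by fact
  have "(\<lambda>i. h (B i))(k := h \<Lambda>) = (\<lambda>i. h ((B(k := \<Lambda>)) i))" for k by auto
  then show ?thesis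
    by (simp add: mu_def hom_add hom_mult hom_sum hom_of_nat jac_def hom_det assms(2) cong: if_cong)
qed

text \<open>
  Integer bounds, satisfied by \<open>0\<close> for every \<open>k\<close>. A derivative then always lowers the bound by one,
  also from \<open>0\<close> to \<open>-1\<close>, and \<open>deg_bound\<close> may be negative without a case distinction.
\<close>

definition deg_le :: "int \<Rightarrow> ('v::finite, 'a::zero) mpoly \<Rightarrow> bool" where
  "deg_le k p \<longleftrightarrow> (\<forall>b\<in>Poly_Mapping.keys p. int (mdeg b) \<le> k)"

lemma mdeg_add: "mdeg (a + b) = mdeg a + mdeg b"
  by (simp add: mdeg_def lookup_add sum.distrib)

lemma deg_le_0 [simp]: "deg_le k 0"
  by (simp add: deg_le_def)

lemma deg_le_add: "deg_le k p \<Longrightarrow> deg_le k q \<Longrightarrow> deg_le k (p + q)"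
  using keys_add[of p q] by (auto simp: deg_le_def)

lemma deg_le_sum: "(\<And>x. x \<in> S \<Longrightarrow> deg_le k (f x)) \<Longrightarrow> deg_le k (sum f S)"
  by (induction S rule: infinite_finite_induct) (simp_all add: deg_le_add)

lemma deg_le_mult: "deg_le k p \<Longrightarrow> deg_le l q \<Longrightarrow> deg_le (k + l) (p * q)"
  using keys_mult[of p q] by (fastforce simp: deg_le_def mdeg_add)

lemma deg_le_Cst: "deg_le 0 (Cst c)"
  by (simp add: deg_le_def Cst_def mdeg_def)

lemma deg_le_prod:
  fixes f :: "'b \<Rightarrow> ('v::finite, 'a::comm_semiring_1) mpoly"
  assumes "finite S" "\<And>x. x \<in> S \<Longrightarrow> deg_le (k x) (f x)"
  shows "deg_le (sum k S) (prod f S)"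
proof -
  have "deg_le 0 (Cst 1 :: ('v, 'a) mpoly)" by (rule deg_le_Cst)
  with assms show ?thesis
    by (induction S rule: finite_induct) (simp_all add: deg_le_mult)
qed

lemma deg_le_partial_deriv:
  assumes "deg_le k p"
  shows "deg_le (k - 1) (partial_deriv v p)"
  unfolding partial_deriv_def
proof (rule deg_le_sum)
  fix b assume b: "b \<in> Poly_Mapping.keys p"
  show "deg_le (k - 1) (monomial (b - unit_exp v) (of_nat (Poly_Mapping.lookup b v) * coeff p b))"
  proof (cases "Poly_Mapping.lookup b v = 0")
    case False
    then have "b = (b - unit_exp v) + unit_exp v"
      by (intro poly_mapping_eqI) (auto simp: lookup_add lookup_minus lookup_single when_def)
    then have "mdeg b = mdeg (b - unit_exp v) + mdeg (unit_exp v)"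
      by (metis mdeg_add)
    moreover have "mdeg (unit_exp v) = 1"
      by (simp add: mdeg_def lookup_single when_def)
    ultimately show ?thesis
      using assms b by (auto simp: deg_le_def)
  qed simp
qed

lemma deg_le_jac:
  assumes "\<And>i. deg_le (k i) (B i)"
  shows "deg_le (\<Sum>i\<in>UNIV. k i - 1) (jac B)"
proof -
  have "deg_le (0 + (\<Sum>i\<in>UNIV. k i - 1)) (of_int (sign p) * (\<Prod>i\<in>UNIV. partial_deriv (p i) (B i)))" for p
    using deg_le_Cst[of "of_int (sign p)"]
    by (intro deg_le_mult deg_le_prod deg_le_partial_deriv assms) (simp_all add: Cst_def)
  then show ?thesis by (auto simp: jac_def det_def intro!: deg_le_sum)
qed

text \<open>
  The \<open>CARD('n)\<close> derivatives in every summand of \<open>mu\<close> lower the sum of the degrees by \<open>CARD('n)\<close>.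
\<close>

lemma deg_le_mu:
  assumes "\<And>i. deg_le (int (d i)) (B i)" "deg_le (int e) \<Lambda>"
  shows "deg_le (deg_bound d e) (mu r B \<Lambda>)"
proof -
  have eq: "int e + (\<Sum>i\<in>UNIV. int (d i) - 1) = deg_bound d e"
    by (simp add: deg_bound_def sum_subtractf)
  have "deg_le (int e + (\<Sum>i\<in>UNIV. int (d i) - 1)) (\<Lambda> * jac B)"
    by (intro deg_le_mult deg_le_jac assms)
  moreover have "deg_le (deg_bound d e) (of_nat (r k) * B k * jac (B(k := \<Lambda>)))" for k
  proof -
    have "deg_le (0 + int (d k) + (\<Sum>i\<in>UNIV. (\<lambda>i. int ((d(k := e)) i)) i - 1)) (of_nat (r k) * B k * jac (B(k := \<Lambda>)))"
      using deg_le_Cst[of "of_nat (r k)"]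
      by (intro deg_le_mult deg_le_jac) (auto simp: assms Cst_def)
    moreover have "int (d k) + (\<Sum>i\<in>UNIV. int ((d(k := e)) i) - 1) = deg_bound d e"
      by (simp add: eq[symmetric] sum.remove[of UNIV k])
    ultimately show ?thesis by simp
  qed
  ultimately show ?thesis
    unfolding mu_def eq by (intro deg_le_add deg_le_sum)
qed

lemma weighted_homogeneous_add:
  "weighted_homogeneous w k p \<Longrightarrow> weighted_homogeneous w k q \<Longrightarrow> weighted_homogeneous w k (p + q)"
  using keys_add[of p q] by (auto simp: weighted_homogeneous_def)

lemma weighted_homogeneous_diff:
  fixes p q :: "('v::finite, 'a::ab_group_add) mpoly"
  shows "weighted_homogeneous w k p \<Longrightarrow> weighted_homogeneous w k q \<Longrightarrow> weighted_homogeneous w k (p - q)"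
  by (auto simp: weighted_homogeneous_def in_keys_iff lookup_minus)

lemma weighted_homogeneous_mult:
  "weighted_homogeneous w k p \<Longrightarrow> weighted_homogeneous w l q \<Longrightarrow> weighted_homogeneous w (k + l) (p * q)"
  using keys_mult[of p q] by (fastforce simp: weighted_homogeneous_def lookup_add distrib_left sum.distrib)

lemma weighted_homogeneous_Cst: "weighted_homogeneous w 0 (Cst c)"
  by (simp add: weighted_homogeneous_def Cst_def)

lemma weighted_homogeneous_Var: "weighted_homogeneous w (w v) (Var v)"
  by (simp add: weighted_homogeneous_def Var_def lookup_single when_def if_distrib cong: if_cong)

lemma weighted_homogeneous_power:
  fixes p :: "('v::finite, 'a::comm_semiring_1) mpoly"
  shows "weighted_homogeneous w k p \<Longrightarrow> weighted_homogeneous w (int n * k) (p ^ n)"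
  using weighted_homogeneous_Cst[of w "1::'a"]
  by (induction n) (simp_all add: weighted_homogeneous_mult distrib_right)

lemma monomial_sum: "monomial b (sum f S) = (\<Sum>x\<in>S. monomial b (f x))"
  by (induction S rule: infinite_finite_induct) (simp_all add: single_add)

text \<open>
  Euler's identity: on a monomial \<open>z\<^sup>b\<close> the operator \<open>\<Sum> w\<^sub>v z\<^sub>v \<partial>\<^sub>v\<close> is multiplication by \<open>\<Sum> w\<^sub>v b\<^sub>v\<close>.
\<close>

lemma euler_weighted_homogeneous:
  fixes p :: "('v::finite, 'a::comm_ring_1) mpoly"
  assumes "weighted_homogeneous w k p"
  shows "(\<Sum>v\<in>UNIV. of_int (w v) * Var v * partial_deriv v p) = of_int k * p"
proof -
  define E where "E p = (\<Sum>v\<in>UNIV. of_int (w v) * Var v * partial_deriv v p)" for p :: "('v, 'a) mpoly"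
  have of_int_mult: "of_int j * monomial b c = monomial b (of_int j * c)" for j b and c :: 'a
    by (simp add: mult_single del: single_of_int flip: single_of_int)
  have "E (monomial b c) = of_int k * monomial b c" if "(\<Sum>v\<in>UNIV. w v * int (Poly_Mapping.lookup b v)) = k" for b c
  proof -
    have "of_int (w v) * Var v * partial_deriv v (monomial b c) =
        monomial b (of_int (w v * int (Poly_Mapping.lookup b v)) * c)" for v
    proof (cases "Poly_Mapping.lookup b v = 0")
      case False
      then have "unit_exp v + (b - unit_exp v) = b"
        by (intro poly_mapping_eqI) (auto simp: lookup_add lookup_minus lookup_single when_def)
      then show ?thesis
        by (simp add: partial_deriv_monomial mult.assoc mult_single Var_def of_int_mult)
    qed (simp add: partial_deriv_monomial)
    then have "E (monomial b c) = monomial b (of_int k * c)"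
      by (simp add: E_def monomial_sum sum_distrib_right flip: that)
    then show ?thesis by (simp add: of_int_mult)
  qed
  then have m: "E (monomial b (Poly_Mapping.lookup p b)) = of_int k * monomial b (Poly_Mapping.lookup p b)"
    if "b \<in> Poly_Mapping.keys p" for b
    using assms that by (simp add: weighted_homogeneous_def)
  have "E p = E (\<Sum>b\<in>Poly_Mapping.keys p. monomial b (Poly_Mapping.lookup p b))"
    by (simp flip: poly_mapping_eq_sum_single)
  also have "\<dots> = (\<Sum>b\<in>Poly_Mapping.keys p. E (monomial b (Poly_Mapping.lookup p b)))"
    unfolding E_def partial_deriv_sum sum_distrib_left by (rule sum.swap)
  also have "\<dots> = of_int k * (\<Sum>b\<in>Poly_Mapping.keys p. monomial b (Poly_Mapping.lookup p b))"
    by (simp add: m sum_distrib_left)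
  finally show ?thesis
    by (simp add: E_def flip: poly_mapping_eq_sum_single)
qed

section \<open>Graded maps and their Jacobian determinant\<close>

text \<open>
  Restriction to the hyperplane \<open>x = 1\<close>. There \<open>u\<^sub>i = y\<^sub>i\<close>, so this inverts the substitution
  \<open>u\<^sub>i = x\<^sup>r\<^sup>i y\<^sub>i\<close>, and a homogeneous polynomial is determined by its restriction.
\<close>

definition dehom :: "('n option, 'a::comm_semiring_1) mpoly \<Rightarrow> ('n, 'a) mpoly" where
  "dehom = psubst (case_option 1 Var)"

lemma dehom_psubst_uvar [simp]:
  fixes p :: "('n, 'a::comm_semiring_1) mpoly"
  shows "dehom (psubst (uvar r) p) = p"
proof -
  have "dehom (uvar r i :: ('n option, 'a) mpoly) = Var i" for i
    by (simp add: dehom_def uvar_def psubst.hom_mult psubst.hom_power)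
  then show ?thesis
    by (simp add: dehom_def psubst_psubst psubst_ident)
qed

lemma psubst_uvar_inject: "psubst (uvar r) p = psubst (uvar r) q \<longleftrightarrow> p = q"
  by (metis dehom_psubst_uvar)

lemma weighted_homogeneous_psubst_uvar:
  "weighted_homogeneous (weight r) 0 (psubst (uvar r) (p :: ('n::finite, 'a::comm_semiring_1) mpoly))"
proof (induction p rule: mpoly_induct)
  case (Var i)
  have "weighted_homogeneous (weight r) (int (r i) * weight r None + weight r (Some i)) (uvar r i)"
    unfolding uvar_def
    by (intro weighted_homogeneous_mult weighted_homogeneous_power weighted_homogeneous_Var)
  moreover have "int (r i) * weight r None + weight r (Some i) = 0"
    by (simp add: weight_def)
  ultimately show ?case by simp
next
  case (mult p q)
  then show ?case
    using weighted_homogeneous_mult[OF mult] by (simp add: psubst.hom_mult)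
qed (simp_all add: weighted_homogeneous_Cst psubst.hom_add weighted_homogeneous_add)

lemma weighted_homogeneous_div_x:
  fixes g :: "('n::finite option, 'a::comm_semiring_1) mpoly"
  assumes "weighted_homogeneous (weight r) k (Var None ^ a * g)"
  shows "weighted_homogeneous (weight r) (k - int a) g"
  unfolding weighted_homogeneous_def
proof
  fix b assume "b \<in> Poly_Mapping.keys g"
  then have "Poly_Mapping.single None a + b \<in> Poly_Mapping.keys (Var None ^ a * g)"
    by (simp add: in_keys_iff Var_power_eq_monomial lookup_monomial_mult)
  with assms have "(\<Sum>v\<in>UNIV. weight r v * int (Poly_Mapping.lookup (Poly_Mapping.single None a + b) v)) = k"
    unfolding weighted_homogeneous_def by blast
  then show "(\<Sum>v\<in>UNIV. weight r v * int (Poly_Mapping.lookup b v)) = k - int a"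
    by (simp add: lookup_add sum_UNIV_option lookup_single weight_def)
qed

lemma graded_form_imp_graded_map:
  assumes "graded_form r G \<Lambda> B"
  shows "graded_map (weight r) (weight r) G"
  unfolding graded_map_def
proof
  fix v
  show "weighted_homogeneous (weight r) (weight r v) (G v)"
  proof (cases v)
    case None
    have "weighted_homogeneous (weight r) (weight r None + 0) (Var None * psubst (uvar r) \<Lambda>)"
      by (intro weighted_homogeneous_mult weighted_homogeneous_Var weighted_homogeneous_psubst_uvar)
    then show ?thesis using assms None by (simp add: graded_form_def)
  next
    case (Some j)
    have "weighted_homogeneous (weight r) (0 - int (r j)) (G (Some j))"
      using assms weighted_homogeneous_psubst_uvar[of r "B j"]
      by (intro weighted_homogeneous_div_x) (simp add: graded_form_def)
    then show ?thesis using Some by (simp add: weight_def)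
  qed
qed

lemma graded_form_unique:
  assumes "graded_form r G \<Lambda> B" "graded_form r G \<Lambda>' B'"
  shows "\<Lambda>' = \<Lambda>" "B' = B"
proof -
  have "Var None ^ 1 * psubst (uvar r) \<Lambda>' = Var None ^ 1 * psubst (uvar r) \<Lambda>"
    using assms by (simp add: graded_form_def)
  then show "\<Lambda>' = \<Lambda>"
    by (metis Var_power_cancel psubst_uvar_inject)
  have "psubst (uvar r) (B' j) = psubst (uvar r) (B j)" for j
    using assms by (simp add: graded_form_def)
  then show "B' = B"
    by (simp add: psubst_uvar_inject fun_eq_iff)
qed

lemma psubst_uvar_monomial:
  fixes c :: "'a::comm_semiring_1"
  shows "psubst (uvar r) (monomial b c) =
    Cst c * (Var None ^ rdeg r b * (\<Prod>i\<in>UNIV. Var (Some i) ^ Poly_Mapping.lookup b i))"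
proof -
  have "(uvar r i :: (_, 'a) mpoly) ^ k = Var None ^ (r i * k) * Var (Some i) ^ k" for i k
    by (simp add: uvar_def power_mult_distrib power_mult)
  then show ?thesis
    unfolding rdeg_def power_sum
    by (simp add: monomial_eq_prod_Var_UNIV psubst.hom_mult psubst.hom_prod psubst.hom_power prod.distrib)
qed

text \<open>
  The exponent vector of a monomial in \<open>x, y\<close> after setting \<open>x = 1\<close>.
\<close>

definition fibre_exp :: "'n::finite option monom \<Rightarrow> 'n monom" where
  "fibre_exp b = (\<Sum>i\<in>UNIV. Poly_Mapping.single i (Poly_Mapping.lookup b (Some i)))"

lemma lookup_fibre_exp: "Poly_Mapping.lookup (fibre_exp b) i = Poly_Mapping.lookup b (Some i)"
  by (simp add: fibre_exp_def lookup_sum lookup_single when_def)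

lemma dehom_monomial: "dehom (monomial b c) = monomial (fibre_exp b) (c::'a::comm_semiring_1)"
  by (simp add: monomial_eq_prod_Var_UNIV prod_UNIV_option dehom_def lookup_fibre_exp
      psubst.hom_mult psubst.hom_prod psubst.hom_power)

lemma weight_eq_rdeg_fibre_exp:
  "(\<Sum>v\<in>UNIV. weight r v * int (Poly_Mapping.lookup b v))
     = int (Poly_Mapping.lookup b None) - int (rdeg r (fibre_exp b))"
  by (simp add: sum_UNIV_option weight_def rdeg_def lookup_fibre_exp sum_negf)

text \<open>
  A monomial \<open>x\<^sup>a y\<^sup>b\<close> of weight \<open>k\<close> satisfies \<open>a = k + \<Sum> r\<^sub>i b\<^sub>i\<close>, so it equals \<open>x\<^sup>k u\<^sup>b\<close>. One of the two
  powers of \<open>x\<close> in the statement is \<open>1\<close>; together they express \<open>x\<^sup>k\<close> for \<open>k\<close> of either sign.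
\<close>

lemma dehom_homogeneous:
  fixes g :: "('n::finite option, 'a::comm_semiring_1) mpoly"
  assumes "weighted_homogeneous (weight r) k g"
  shows "Var None ^ nat k * psubst (uvar r) (dehom g) = Var None ^ nat (- k) * g"
proof -
  let ?E = "\<lambda>g. psubst (uvar r) (dehom g) :: ('n option, 'a) mpoly"
  have m: "Var None ^ nat k * ?E (monomial b c) = Var None ^ nat (- k) * monomial b c"
    if "(\<Sum>v\<in>UNIV. weight r v * int (Poly_Mapping.lookup b v)) = k" for b c
  proof -
    let ?Y = "\<Prod>i\<in>UNIV. Var (Some i) ^ Poly_Mapping.lookup b (Some i) :: ('n option, 'a) mpoly"
    have b: "monomial b c = Cst c * (Var None ^ Poly_Mapping.lookup b None * ?Y)"
      by (simp add: monomial_eq_prod_Var_UNIV prod_UNIV_option)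
    have eq: "nat k + rdeg r (fibre_exp b) = nat (- k) + Poly_Mapping.lookup b None"
      using that unfolding weight_eq_rdeg_fibre_exp by linarith
    have "Var None ^ nat k * ?E (monomial b c) = Cst c * (Var None ^ (nat k + rdeg r (fibre_exp b)) * ?Y)"
      unfolding dehom_monomial psubst_uvar_monomial lookup_fibre_exp power_add by (simp only: ac_simps)
    also have "\<dots> = Var None ^ nat (- k) * monomial b c"
      unfolding eq b power_add by (simp only: ac_simps)
    finally show ?thesis .
  qed
  let ?S = "\<Sum>b\<in>Poly_Mapping.keys g. monomial b (Poly_Mapping.lookup g b)"
  have "Var None ^ nat k * ?E ?S = Var None ^ nat (- k) * ?S"
    unfolding dehom_def psubst.hom_sum sum_distrib_left unfolding dehom_def[symmetric]
    by (intro sum.cong refl m) (use assms in \<open>simp add: weighted_homogeneous_def\<close>)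
  then show ?thesis by (simp flip: poly_mapping_eq_sum_single)
qed

lemma V_sum: "(\<And>x. x \<in> S \<Longrightarrow> f x \<in> V r j) \<Longrightarrow> sum f S \<in> V r j"
  using keys_sum[of f S] by (fastforce simp: V_def)

text \<open>
  For weight \<open>- r\<^sub>j\<close> the exponent of \<open>x\<close> is \<open>\<Sum> r\<^sub>i b\<^sub>i - r\<^sub>j\<close>; it is nonnegative, which is the condition
  defining \<open>V r j\<close>.
\<close>

lemma dehom_in_V:
  fixes g :: "('n::finite option, 'a::comm_semiring_1) mpoly"
  assumes "weighted_homogeneous (weight r) (- int (r j)) g"
  shows "dehom g \<in> V r j"
proof -
  have "dehom (monomial b (Poly_Mapping.lookup g b)) \<in> V r j" if "b \<in> Poly_Mapping.keys g" for b
  proof -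
    have "(\<Sum>v\<in>UNIV. weight r v * int (Poly_Mapping.lookup b v)) = - int (r j)"
      using assms that by (simp add: weighted_homogeneous_def)
    then have "r j \<le> rdeg r (fibre_exp b)"
      unfolding weight_eq_rdeg_fibre_exp by linarith
    then show ?thesis by (auto simp: V_def dehom_monomial split: if_splits)
  qed
  then have "(\<Sum>b\<in>Poly_Mapping.keys g. dehom (monomial b (Poly_Mapping.lookup g b))) \<in> V r j"
    by (rule V_sum)
  moreover have "(\<Sum>b\<in>Poly_Mapping.keys g. dehom (monomial b (Poly_Mapping.lookup g b)))
      = dehom (\<Sum>b\<in>Poly_Mapping.keys g. monomial b (Poly_Mapping.lookup g b))"
    by (simp add: dehom_def psubst.hom_sum)
  ultimately show ?thesis by (simp flip: poly_mapping_eq_sum_single)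
qed

lemma graded_map_imp_graded_form:
  assumes "graded_map (weight r) (weight r) G"
  shows "graded_form r G (dehom (G None)) (\<lambda>j. dehom (G (Some j)))"
proof -
  have w: "weighted_homogeneous (weight r) 1 (G None)"
      "weighted_homogeneous (weight r) (- int (r j)) (G (Some j))" for j
    using assms[unfolded graded_map_def, THEN spec, of None]
      assms[unfolded graded_map_def, THEN spec, of "Some j"] by (simp_all add: weight_def)
  show ?thesis
    unfolding graded_form_def
    using dehom_homogeneous[OF w(1)] dehom_homogeneous[OF w(2)] dehom_in_V[OF w(2)] by simp
qed

lemma graded_map_iff_ex1_graded_form:
  "graded_map (weight r) (weight r) G \<longleftrightarrow> (\<exists>!\<Lambda>B. graded_form r G (fst \<Lambda>B) (snd \<Lambda>B))"
proof
  assume "graded_map (weight r) (weight r) G"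
  from graded_map_imp_graded_form[OF this]
  show "\<exists>!\<Lambda>B. graded_form r G (fst \<Lambda>B) (snd \<Lambda>B)"
    by (intro ex1I[of _ "(dehom (G None), \<lambda>j. dehom (G (Some j)))"])
       (auto dest: graded_form_unique simp: prod_eq_iff)
qed (auto dest: graded_form_imp_graded_map)

text \<open>
  Conversely, the condition defining \<open>V r j\<close> is what makes every monomial of \<open>B\<^sub>j\<close> divisible by
  \<open>x\<^sup>r\<^sup>j\<close> after the substitution \<open>u\<^sub>i = x\<^sup>r\<^sup>i y\<^sub>i\<close>.
\<close>

lemma graded_form_exists:
  fixes B :: "('n::finite, complex) pmap"
  assumes "\<And>j. B j \<in> V r j"
  obtains G where "graded_form r G \<Lambda> B"
proof -
  have "\<exists>g. Var None ^ r j * g = psubst (uvar r) (B j)" for j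
  proof -
    have "\<exists>g. Var None ^ r j * g = psubst (uvar r) (monomial b c)" if "r j \<le> rdeg r b" for b and c :: complex
    proof
      note psubst_uvar_monomial[of r b c]
      also have "Var None ^ rdeg r b = Var None ^ r j * Var None ^ (rdeg r b - r j)"
        using that by (simp flip: power_add)
      finally show "Var None ^ r j * (Cst c * (Var None ^ (rdeg r b - r j) *
          (\<Prod>i\<in>UNIV. Var (Some i) ^ Poly_Mapping.lookup b i))) = psubst (uvar r) (monomial b c)"
        by (simp only: ac_simps)
    qed
    then obtain g where g: "r j \<le> rdeg r b \<Longrightarrow> Var None ^ r j * g b c = psubst (uvar r) (monomial b c)" for b and c :: complex
      by metis
    let ?S = "\<Sum>b\<in>Poly_Mapping.keys (B j). monomial b (Poly_Mapping.lookup (B j) b)"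
    have "Var None ^ r j * (\<Sum>b\<in>Poly_Mapping.keys (B j). g b (Poly_Mapping.lookup (B j) b)) = psubst (uvar r) ?S"
      unfolding psubst.hom_sum sum_distrib_left
      by (intro sum.cong refl g) (use assms in \<open>auto simp: V_def\<close>)
    then show ?thesis by (auto simp flip: poly_mapping_eq_sum_single)
  qed
  then obtain g where "Var None ^ r j * g j = psubst (uvar r) (B j)" for j
    by metis
  then have "graded_form r (case_option (Var None * psubst (uvar r) \<Lambda>) g) \<Lambda> B"
    using assms by (simp add: graded_form_def)
  then show ?thesis by (rule that)
qed

lemma partial_deriv_psubst_uvar:
  "partial_deriv (Some i) (psubst (uvar r) p) = Var None ^ r i * psubst (uvar r) (partial_deriv i p)"
  by (induction p rule: mpoly_induct)
     (simp_all add: psubst.hom_add psubst.hom_mult partial_deriv_add partial_deriv_mult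
       partial_deriv_Var partial_deriv_power uvar_def algebra_simps)

text \<open>
  The derivatives along the fibres \<open>x = const\<close> of polynomials which are, up to powers of \<open>x\<close>, functions
  of \<open>u\<close>. Every row contributes its own power of \<open>x\<close>, and every column \<open>j\<close> a factor
  \<open>\<partial>u\<^sub>j/\<partial>y\<^sub>j = x\<^sup>r\<^sup>j\<close>.
\<close>

lemma det_fibre_derivatives:
  fixes F :: "'n::finite \<Rightarrow> ('n option, 'a::comm_ring_1) mpoly"
  assumes "\<And>i. Var None ^ s i * F i = Var None ^ t i * psubst (uvar r) (C i)"
  shows "Var None ^ (\<Sum>i\<in>UNIV. s i) * det (\<chi> i j. partial_deriv (Some j) (F i))
       = Var None ^ (\<Sum>i\<in>UNIV. t i + r i) * psubst (uvar r) (jac C)"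
proof -
  have x: "partial_deriv (Some j) (Var None ^ k * p) = Var None ^ k * partial_deriv (Some j) p" for j k and p :: "('n option, 'a) mpoly"
    by (simp add: partial_deriv_mult partial_deriv_power partial_deriv_Var)
  have "Var None ^ (\<Sum>i\<in>UNIV. s i) * det (\<chi> i j. partial_deriv (Some j) (F i))
      = det (\<chi> i j. partial_deriv (Some j) (Var None ^ s i * F i))"
    by (simp add: x det_scale_rows power_sum)
  also have "\<dots> = det (\<chi> i j. Var None ^ t i * (Var None ^ r j * psubst (uvar r) (partial_deriv j (C i))))"
    by (simp add: assms x partial_deriv_psubst_uvar)
  also have "\<dots> = Var None ^ (\<Sum>i\<in>UNIV. t i) * (Var None ^ (\<Sum>i\<in>UNIV. r i) * psubst (uvar r) (jac C))"
    by (simp only: det_scale_rows det_scale_columns power_sum jac_def psubst.hom_det vec_lambda_beta)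
  finally show ?thesis by (simp add: sum.distrib power_add mult.assoc)
qed

text \<open>
  Multiplying the column of \<open>\<partial>/\<partial>x\<close> by \<open>x\<close> and subtracting \<open>r\<^sub>i y\<^sub>i\<close> times the column of \<open>\<partial>/\<partial>y\<^sub>i\<close> turns it,
  by Euler's identity, into the column of the components of \<open>G\<close> times their weights. The
  expansion along this column is \<open>mu\<close>, after the powers of \<open>x\<close> have been collected and cancelled.
\<close>

lemma jac_graded_form:
  assumes gf: "graded_form r G \<Lambda> B"
  shows "jac G = psubst (uvar r) (mu r B \<Lambda>)"
proof -
  let ?X = "Var None :: ('a option, complex) mpoly"
  let ?\<phi> = "psubst (uvar r)"
  let ?m = "\<Sum>i\<in>UNIV. r i"
  let ?J = "\<lambda>F. det (\<chi> i j. partial_deriv (Some j) (F i)) :: ('a option, complex) mpoly"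
  have G0: "G None = ?X * ?\<phi> \<Lambda>" and Gj: "?X ^ r j * G (Some j) = ?\<phi> (B j)" for j
    using gf by (simp_all add: graded_form_def)
  define A where "A = (\<chi> i j. partial_deriv j (G i))"
  define t where "t i = - (of_nat (r i) * Var (Some i) :: ('a option, complex) mpoly)" for i
  have "(A ** column_operation ?X t) $ i $ None = of_int (weight r i) * G i" for i
  proof -
    have "weighted_homogeneous (weight r) (weight r i) (G i)"
      using graded_form_imp_graded_map[OF gf] by (simp add: graded_map_def)
    from euler_weighted_homogeneous[OF this] show ?thesis
      by (simp add: times_column_operation sum_UNIV_option A_def t_def weight_def ac_simps)
  qed
  then have "det (A ** column_operation ?X t) = G None * ?J (\<lambda>i. G (Some i))
      + (\<Sum>k\<in>UNIV. of_nat (r k) * G (Some k) * ?J (\<lambda>i. G (if i = k then None else Some i)))"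
    by (subst det_expand_column_None)
       (simp add: times_column_operation A_def weight_def sum_negf)
  moreover have "det (A ** column_operation ?X t) = ?X * jac G"
    by (simp add: det_mul det_column_operation A_def jac_def mult.commute)
  ultimately have XJ: "?X * jac G = G None * ?J (\<lambda>i. G (Some i))
      + (\<Sum>k\<in>UNIV. of_nat (r k) * G (Some k) * ?J (\<lambda>i. G (if i = k then None else Some i)))"
    by simp
  \<comment> \<open>Row \<open>j\<close> needs the factor \<open>x\<^sup>r\<^sup>j\<close> to become a function of \<open>u\<close>.\<close>
  have J0: "?X ^ ?m * ?J (\<lambda>i. G (Some i)) = ?X ^ ?m * ?\<phi> (jac B)"
    using det_fibre_derivatives[of r "\<lambda>i. G (Some i)" "\<lambda>_. 0" r B] by (simp add: Gj)
  \<comment> \<open>In row \<open>k\<close> the factor \<open>x\<^sup>r\<^sup>k\<close> is spent on \<open>G\<^sub>k\<close> instead, and \<open>x\<Lambda>\<close> brings its own factor \<open>x\<close>.\<close>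
  have Jk: "?X ^ ?m * (G (Some k) * ?J (\<lambda>i. G (if i = k then None else Some i)))
      = ?X ^ ?m * (?X * ?\<phi> (B k * jac (B(k := \<Lambda>))))" for k
  proof -
    let ?s = "r(k := 0)" and ?t = "(\<lambda>_. 0)(k := 1 :: nat)"
    have ms: "?m = r k + (\<Sum>i\<in>UNIV. ?s i)"
      by (simp add: sum.remove[of UNIV k])
    have mt: "(\<Sum>i\<in>UNIV. ?t i + r i) = Suc ?m"
      by (simp add: sum.distrib)
    have "?X ^ (\<Sum>i\<in>UNIV. ?s i) * ?J (\<lambda>i. G (if i = k then None else Some i))
        = ?X ^ (\<Sum>i\<in>UNIV. ?t i + r i) * ?\<phi> (jac (B(k := \<Lambda>)))"
      by (rule det_fibre_derivatives) (simp add: G0 Gj)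
    then have "?X ^ r k * G (Some k) * (?X ^ (\<Sum>i\<in>UNIV. ?s i) * ?J (\<lambda>i. G (if i = k then None else Some i)))
        = ?\<phi> (B k) * (?X ^ Suc ?m * ?\<phi> (jac (B(k := \<Lambda>))))"
      unfolding mt Gj by (rule arg_cong)
    then show ?thesis
      unfolding psubst.hom_mult by (subst (1) ms) (simp add: power_add ac_simps)
  qed
  have "?X ^ Suc ?m * jac G = ?X ^ ?m * (?X * jac G)"
    by (simp add: ac_simps)
  also have "\<dots> = G None * (?X ^ ?m * ?J (\<lambda>i. G (Some i)))
      + (\<Sum>k\<in>UNIV. of_nat (r k) * (?X ^ ?m * (G (Some k) * ?J (\<lambda>i. G (if i = k then None else Some i)))))"
    unfolding XJ distrib_left sum_distrib_left by (simp only: ac_simps)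
  also have "\<dots> = ?X ^ Suc ?m * ?\<phi> (mu r B \<Lambda>)"
    unfolding J0 Jk G0 mu_def psubst.hom_add psubst.hom_sum psubst.hom_mult psubst.hom_of_nat
      distrib_left sum_distrib_left power_Suc by (simp only: ac_simps)
  finally show ?thesis by (rule Var_power_cancel)
qed

text \<open>
  The gradient of \<open>P\<^sub>i = B\<^sub>i \<Lambda>\<^sup>r\<^sup>i\<close> is \<open>\<Lambda>\<^sup>r\<^sup>i\<close> times that of \<open>B\<^sub>i\<close> plus a multiple of the gradient of \<open>\<Lambda>\<close>,
  so the Jacobian matrix is a rank one update of a row scaling of that of \<open>B\<close>.
\<close>

lemma jac_Gbar:
  assumes "(\<Sum>i\<in>UNIV. r i) \<ge> 1"
  shows "jac (Gbar r \<Lambda> B) = mu r B \<Lambda> * \<Lambda> ^ ((\<Sum>i\<in>UNIV. r i) - 1)"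
proof -
  let ?m = "\<Sum>i\<in>UNIV. r i"
  let ?M = "\<lambda>i j. \<Lambda> ^ r i * partial_deriv j (B i)"
  have term_eq: "of_nat (r k) * B k * \<Lambda> ^ (r k - 1) * det (\<chi> i j. if i = k then partial_deriv j \<Lambda> else ?M i j)
      = \<Lambda> ^ (?m - 1) * (of_nat (r k) * B k * jac (B(k := \<Lambda>)))" for k
  proof (cases "r k = 0")
    case False
    let ?s = "r(k := 0)"
    have ms: "?m = r k + (\<Sum>i\<in>UNIV. ?s i)"
      by (simp add: sum.remove[of UNIV k])
    have "(\<chi> i j. if i = k then partial_deriv j \<Lambda> else ?M i j)
        = (\<chi> i j. \<Lambda> ^ ?s i * partial_deriv j ((B(k := \<Lambda>)) i))"
      by (simp add: vec_eq_iff)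
    then have "det (\<chi> i j. if i = k then partial_deriv j \<Lambda> else ?M i j) = \<Lambda> ^ (\<Sum>i\<in>UNIV. ?s i) * jac (B(k := \<Lambda>))"
      by (simp only: det_scale_rows power_sum jac_def)
    moreover have "?m - 1 = (r k - 1) + (\<Sum>i\<in>UNIV. ?s i)"
      using False ms by linarith
    ultimately show ?thesis by (simp only: power_add ac_simps)
  qed simp
  have "jac (Gbar r \<Lambda> B) = det (\<chi> i j. ?M i j + of_nat (r i) * B i * \<Lambda> ^ (r i - 1) * partial_deriv j \<Lambda>)"
    by (simp add: jac_def Gbar_def partial_deriv_mult partial_deriv_power ac_simps)
  also have "\<dots> = \<Lambda> ^ ?m * jac B
      + (\<Sum>k\<in>UNIV. of_nat (r k) * B k * \<Lambda> ^ (r k - 1) *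
           det (\<chi> i j. if i = k then partial_deriv j \<Lambda> else ?M i j))"
    by (simp add: det_rank_one_update det_scale_rows power_sum jac_def)
  also have "\<Lambda> ^ ?m = \<Lambda> ^ (?m - 1) * \<Lambda>"
    using assms by (cases ?m) auto
  finally show ?thesis
    unfolding term_eq by (simp add: mu_def distrib_left sum_distrib_left ac_simps)
qed

section \<open>Irreducibility of a variable and automorphisms\<close>

text \<open>
  Sending each variable \<open>v\<close> to \<open>t v\<close> embeds the polynomials into polynomials in \<open>t\<close> whose degree in \<open>t\<close>
  is the total degree. This degree is additive over an integral domain, so one of two factors of a
  variable has degree \<open>0\<close>; such a polynomial takes the same value at \<open>t = 1\<close>, where it is itself, and
  at \<open>t = 0\<close>, where it is its constant term. Naming the variables by natural numbers orders the
  monomials, which excludes zero divisors among the coefficients of the powers of \<open>t\<close>.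
\<close>

lemma Var_mult_const:
  fixes p q :: "('v::finite, 'a::idom) mpoly"
  assumes "p * q = Var v"
  shows "p \<in> range Cst \<or> q \<in> range Cst"
proof -
  obtain \<nu> :: "'v \<Rightarrow> nat" where \<nu>: "inj \<nu>"
    using finite_imp_inj_to_nat_seg[OF finite[of "UNIV :: 'v set"]] by blast
  define c :: "'a \<Rightarrow> (nat, 'a) mpoly poly" where "c a = [:Cst a:]" for a
  interpret c: semiring_hom c
    by unfold_locales (simp_all add: c_def Cst_add Cst_mult one_pCons)
  define h where "h = insertion c (\<lambda>v. [:0, Var (\<nu> v):])"
  interpret h: semiring_hom h
    unfolding h_def by (rule c.semiring_hom_insertion)
  have "semiring_hom (\<lambda>f. poly f a)" for a :: "(nat, 'a) mpoly"
    by unfold_locales simp_all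
  then have at: "semiring_hom (\<lambda>p. poly (h p) a)" for a
    by (rule semiring_hom_comp[of "\<lambda>f. poly f a" h for a]) (rule h.semiring_hom_axioms)
  have at_1: "poly (h p) 1 = psubst (\<lambda>v. Var (\<nu> v)) p" for p
    by (rule hom_eqI[OF at semiring_hom_psubst]) (simp_all add: h_def c_def)
  have at_0: "poly (h p) 0 \<in> range Cst" for p
  proof (induction p rule: mpoly_induct)
    case (Cst a)
    show ?case by (simp add: h_def c_def)
  next
    case (Var v)
    show ?case using rangeI[of Cst "0::'a"] by (simp add: h_def)
  next
    case (add p q)
    then show ?case by (auto simp: h.hom_add simp flip: Cst_add)
  next
    case (mult p q)
    then show ?case by (auto simp: h.hom_mult simp flip: Cst_mult)
  qed
  have const: "p \<in> range Cst" if deg: "degree (h p) = 0" for p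
  proof -
    obtain f where "h p = [:f:]" using deg by (rule degree_eq_zeroE)
    then obtain a where "psubst (\<lambda>v. Var (\<nu> v)) p = Cst a"
      using at_0[of p] at_1[of p] by auto
    then have "psubst (\<lambda>i. Var (inv \<nu> i)) (psubst (\<lambda>v. Var (\<nu> v)) p) = Cst a"
      by simp
    then show ?thesis by (auto simp: psubst_psubst \<nu> psubst_ident)
  qed
  have "Var (\<nu> v) \<noteq> (0 :: (nat, 'a) mpoly)"
    by (metis Var_def lookup_single_eq lookup_zero zero_neq_one)
  moreover have "h p * h q = [:0, Var (\<nu> v):]"
    using h.hom_mult[of p q] by (simp add: assms) (simp add: h_def)
  ultimately have "h p * h q \<noteq> 0" "degree (h p * h q) = 1"
    by simp_all
  then have "degree (h p) + degree (h q) = 1"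
    by (metis degree_mult_eq mult_zero_left mult_zero_right)
  then have "degree (h p) = 0 \<or> degree (h q) = 0" by linarith
  then show ?thesis using const by blast
qed

lemma Var_not_const: "Var v \<noteq> Cst (c::'a::comm_semiring_1)"
proof
  assume "Var v = Cst c"
  then have "partial_deriv v (Var v) = partial_deriv v (Cst c)" by simp
  then show False by (simp add: partial_deriv_Var)
qed

text \<open>
  Applying an inverse \<open>H\<close> to \<open>G\<^sub>1 = x\<Lambda>\<close> factors the variable \<open>x\<close> as \<open>H\<^sub>1\<close> times \<open>\<Lambda> \<circ> H\<close>. So one factor is
  constant, and applying \<open>G\<close> again shows that \<open>x\<close> or \<open>\<Lambda>\<close> is constant.
\<close>

lemma graded_form_not_automorphism:
  assumes gf: "graded_form r G \<Lambda> B" and "\<Lambda> \<notin> range Cst"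
  shows "\<not> poly_automorphism G"
proof
  assume "poly_automorphism G"
  then obtain H where H: "\<And>v. psubst H (G v) = Var v" "\<And>v. psubst G (H v) = Var v"
    unfolding poly_automorphism_def by blast
  have GH: "psubst G (psubst H p) = p" for p
    by (simp add: psubst_psubst H psubst_ident)
  let ?L = "psubst (uvar r) \<Lambda>"
  have "H None * psubst H ?L = Var None"
    using H(1)[of None] gf by (simp add: graded_form_def psubst.hom_mult)
  then consider c where "H None = Cst c" | c where "psubst H ?L = Cst c"
    using Var_mult_const by blast
  then show False
  proof cases
    case 1
    then show False using H(2)[of None] Var_not_const[of None c] by (metis psubst_Cst)
  next
    case 2
    then have "?L = Cst c" using GH[of ?L] by simp
    then have "\<Lambda> = Cst c" by (metis dehom_psubst_uvar psubst_Cst)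
    then show False using assms(2) by blast
  qed
qed

lemma keller_graded_form:
  assumes "graded_form r G \<Lambda> B"
  shows "keller G \<longleftrightarrow> (\<exists>\<kappa>. \<kappa> \<noteq> 0 \<and> mu r B \<Lambda> = Cst \<kappa>)"
proof -
  have "jac G = Cst \<kappa> \<longleftrightarrow> mu r B \<Lambda> = Cst \<kappa>" for \<kappa>
    unfolding jac_graded_form[OF assms] by (metis psubst_uvar_inject psubst_Cst)
  then show ?thesis by (simp add: keller_def)
qed

section \<open>Coefficient equations for a nonzero constant\<close>

lemma total_degree_le_iff: "total_degree p \<le> d \<longleftrightarrow> deg_le (int d) p"
  by (auto simp: total_degree_def deg_le_def)

lemma mdeg_eq_0_iff: "mdeg b = 0 \<longleftrightarrow> b = 0"
  by (auto simp: mdeg_def poly_mapping_eq_iff fun_eq_iff)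

lemma eq_Cst_iff: "p = Cst (coeff p 0) \<longleftrightarrow> (\<forall>b. 1 \<le> mdeg b \<longrightarrow> coeff p b = 0)"
proof -
  have "mdeg b \<ge> 1 \<longleftrightarrow> b \<noteq> 0" for b :: "'a monom"
    using mdeg_eq_0_iff[of b] by (cases "mdeg b") simp_all
  moreover have "p = Cst (coeff p 0) \<longleftrightarrow> (\<forall>b. b \<noteq> 0 \<longrightarrow> coeff p b = 0)"
  proof
    assume "\<forall>b. b \<noteq> 0 \<longrightarrow> coeff p b = 0"
    then show "p = Cst (coeff p 0)"
      by (intro poly_mapping_eqI) (auto simp: coeff_def Cst_def lookup_single when_def)
  next
    assume p: "p = Cst (coeff p 0)"
    show "\<forall>b. b \<noteq> 0 \<longrightarrow> coeff p b = 0"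
      by (subst p) (simp add: coeff_def Cst_def lookup_single when_def)
  qed
  ultimately show ?thesis by (simp only:)
qed

lemma coeff_Cst_0 [simp]: "coeff (Cst c) 0 = c"
  by (simp add: coeff_def Cst_def)

lemma in_range_Cst_iff:
  fixes p :: "('a::finite, 'b::zero) mpoly"
  shows "p \<in> range Cst \<longleftrightarrow> \<not> total_degree p \<ge> 1"
proof -
  have "p \<in> range Cst \<longleftrightarrow> p = Cst (coeff p 0)"
  proof
    assume "p \<in> range Cst"
    then obtain c where "p = Cst c" by blast
    then show "p = Cst (coeff p 0)" by simp
  qed (rule range_eqI)
  also have "\<dots> \<longleftrightarrow> total_degree p \<le> 0"
  proof -
    have "int (mdeg b) \<le> int 0 \<longleftrightarrow> \<not> 1 \<le> mdeg b" for b :: "'a monom"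
      by linarith
    moreover have "b \<in> Poly_Mapping.keys p \<longleftrightarrow> coeff p b \<noteq> 0" for b
      by (simp add: in_keys_iff coeff_def)
    ultimately have "(\<forall>b. 1 \<le> mdeg b \<longrightarrow> coeff p b = 0) \<longleftrightarrow> (\<forall>b\<in>Poly_Mapping.keys p. int (mdeg b) \<le> int 0)"
      by metis
    then show ?thesis
      by (simp only: eq_Cst_iff total_degree_le_iff deg_le_def)
  qed
  finally have "p \<in> range Cst \<longleftrightarrow> total_degree p \<le> 0" .
  moreover have "total_degree p \<le> 0 \<longleftrightarrow> \<not> total_degree p \<ge> 1" by linarith
  ultimately show ?thesis by (simp only:)
qed

text \<open>
  Only the finitely many coefficients within the degree bound have to be tested, which is why the
  equations of the scheme stop at \<open>deg_bound\<close>.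
\<close>

lemma const_nonzero_iff_coeffs:
  fixes p :: "('v::finite, 'a::zero) mpoly"
  assumes "deg_le D p"
  shows "(\<exists>\<kappa>. \<kappa> \<noteq> 0 \<and> p = Cst \<kappa>) \<longleftrightarrow>
    (\<forall>b. 1 \<le> mdeg b \<and> int (mdeg b) \<le> D \<longrightarrow> coeff p b = 0) \<and> coeff p 0 \<noteq> 0"
proof -
  have "(\<exists>\<kappa>. \<kappa> \<noteq> 0 \<and> p = Cst \<kappa>) \<longleftrightarrow> p = Cst (coeff p 0) \<and> coeff p 0 \<noteq> 0"
    by (metis coeff_Cst_0)
  moreover have "coeff p b = 0" if "\<not> int (mdeg b) \<le> D" for b
    using assms that by (auto simp: deg_le_def in_keys_iff coeff_def)
  then have "(\<forall>b. 1 \<le> mdeg b \<longrightarrow> coeff p b = 0) \<longleftrightarrow>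
      (\<forall>b. 1 \<le> mdeg b \<and> int (mdeg b) \<le> D \<longrightarrow> coeff p b = 0)"
    by metis
  ultimately show ?thesis by (simp only: eq_Cst_iff)
qed

lemma finite_mdeg_le: "finite {b :: 'v::finite monom. mdeg b \<le> d}"
proof (rule finite_imageD)
  have "Poly_Mapping.lookup b v \<le> mdeg b" for b :: "'v monom" and v
    unfolding mdeg_def by (rule member_le_sum) auto
  then have "Poly_Mapping.lookup ` {b :: 'v monom. mdeg b \<le> d} \<subseteq> (\<Pi>\<^sub>E v\<in>UNIV. {..d})"
    by (fastforce intro: order_trans)
  then show "finite (Poly_Mapping.lookup ` {b :: 'v monom. mdeg b \<le> d})"
    by (rule finite_subset) (simp add: finite_PiE)
qed (auto intro!: inj_onI poly_mapping_eqI)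

definition map_coeffs :: "('a::comm_ring_1 \<Rightarrow> 'b::comm_ring_1) \<Rightarrow> ('v, 'a) mpoly \<Rightarrow> ('v, 'b) mpoly" where
  "map_coeffs h = insertion (\<lambda>c. Cst (h c)) Var"

context ring_hom
begin

lemma ring_hom_map_coeffs: "ring_hom (map_coeffs h)"
proof -
  interpret Ch: ring_hom "\<lambda>c. Cst (h c)"
    unfolding ring_hom_def by (rule semiring_hom_comp[of Cst h]) (rule Cst.semiring_hom_axioms semiring_hom_axioms)+
  show ?thesis unfolding map_coeffs_def by (rule Ch.ring_hom_insertion)
qed

lemma map_coeffs_monomial: "map_coeffs h (monomial b c) = monomial b (h c)"
proof -
  interpret Ch: semiring_hom "\<lambda>c. Cst (h c)"
    by (rule semiring_hom_comp[of Cst h]) (rule Cst.semiring_hom_axioms semiring_hom_axioms)+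
  show ?thesis
    unfolding map_coeffs_def Ch.insertion_monomial monomial_eq_Cst_mult[of b "h c"] monomial_1_eq_prod_Var ..
qed

lemma coeff_map_coeffs: "coeff (map_coeffs h p) b = h (coeff p b)"
proof -
  interpret map: ring_hom "map_coeffs h" by (rule ring_hom_map_coeffs)
  show ?thesis
    by (induction p rule: monomial_add_induct)
       (simp_all add: map_coeffs_monomial map.hom_add hom_add coeff_def lookup_single when_def lookup_add)
qed

lemma map_coeffs_partial_deriv: "map_coeffs h (partial_deriv v p) = partial_deriv v (map_coeffs h p)"
proof -
  interpret map: ring_hom "map_coeffs h" by (rule ring_hom_map_coeffs)
  show ?thesis
    by (induction p rule: monomial_add_induct)
       (simp_all add: map_coeffs_monomial map.hom_add partial_deriv_add partial_deriv_monomial hom_mult hom_of_nat)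
qed

end

lemma semiring_hom_of_int: "semiring_hom (of_int :: int \<Rightarrow> 'a::comm_ring_1)"
  by unfold_locales simp_all

text \<open>
  Applying the specialisation of coordinates to every coefficient is a ring homomorphism that commutes
  with differentiation, hence with \<open>mu\<close>, and it takes the generic polynomials to \<open>B\<close> and \<open>\<Lambda>\<close>.
\<close>

lemma insertion_generic_mu:
  fixes B :: "('n::finite, 'a::comm_ring_1) pmap"
  assumes "\<And>j. B j \<in> V r j" "\<And>j. deg_le (int (d j)) (B j)" "deg_le (int d\<Lambda>) \<Lambda>"
  shows "insertion of_int (coords B \<Lambda>) (generic_mu r d d\<Lambda> b) = coeff (mu r B \<Lambda>) b"
proof -
  interpret of_int: semiring_hom "of_int :: int \<Rightarrow> 'a" by (rule semiring_hom_of_int)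
  let ?h = "insertion of_int (coords B \<Lambda>)"
  interpret h: ring_hom ?h unfolding ring_hom_def by (rule of_int.semiring_hom_insertion)
  interpret map: ring_hom "map_coeffs ?h" by (rule h.ring_hom_map_coeffs)
  have gen: "map_coeffs ?h (generic_poly r d d\<Lambda> k) = p"
    if "Poly_Mapping.keys p \<subseteq> exps r d d\<Lambda> k" "\<And>b. coords B \<Lambda> (k, b) = coeff p b" for k p
  proof -
    have "finite (exps r d d\<Lambda> k)"
      by (rule finite_subset[OF _ finite_mdeg_le[of "case k of None \<Rightarrow> d\<Lambda> | Some j \<Rightarrow> d j"]])
         (auto simp: exps_def split: option.splits)
    moreover have "map_coeffs ?h (generic_poly r d d\<Lambda> k) = (\<Sum>b\<in>exps r d d\<Lambda> k. monomial b (coeff p b))"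
      by (simp add: generic_poly_def map.hom_sum h.map_coeffs_monomial that)
    moreover have "(\<Sum>b\<in>Poly_Mapping.keys p. monomial b (Poly_Mapping.lookup p b)) = (\<Sum>b\<in>exps r d d\<Lambda> k. monomial b (coeff p b))"
      unfolding coeff_def by (rule sum.mono_neutral_left) (use calculation that in \<open>auto simp: in_keys_iff\<close>)
    ultimately show ?thesis by (simp flip: poly_mapping_eq_sum_single)
  qed
  have "map_coeffs ?h (generic_poly r d d\<Lambda> (Some j)) = B j" for j
    using assms(1,2)[of j] by (intro gen) (auto simp: exps_def V_def deg_le_def coords_def)
  moreover have "map_coeffs ?h (generic_poly r d d\<Lambda> None) = \<Lambda>"
    using assms(3) by (intro gen) (auto simp: exps_def deg_le_def coords_def)
  ultimately have "map_coeffs ?h (mu r (\<lambda>j. generic_poly r d d\<Lambda> (Some j)) (generic_poly r d d\<Lambda> None)) = mu r B \<Lambda>"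
    by (simp add: mu_hom[OF h.ring_hom_map_coeffs h.map_coeffs_partial_deriv])
  then show ?thesis
    by (simp add: generic_mu_def flip: h.coeff_map_coeffs)
qed

section \<open>Points of the scheme and rescaling classes\<close>

lemma Cst_inverse_mult: "c \<noteq> 0 \<Longrightarrow> Cst (inverse c) * (Cst (c::'a::field) * p) = p"
  by (simp flip: mult.assoc Cst_mult)

lemma keys_Cst_mult: "Poly_Mapping.keys (Cst c * p) \<subseteq> Poly_Mapping.keys (p :: ('v, 'a::comm_semiring_1) mpoly)"
  using keys_mult[of "Cst c" p] by (fastforce simp: Cst_def split: if_splits)

lemma Cst_mult_in_V:
  fixes p :: "('n::finite, 'a::comm_semiring_1) mpoly"
  shows "p \<in> V r j \<Longrightarrow> Cst c * p \<in> V r j"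
  using keys_Cst_mult[of c p] by (auto simp: V_def)

lemma deg_le_Cst_mult:
  fixes p :: "('n::finite, 'a::comm_semiring_1) mpoly"
  shows "deg_le k p \<Longrightarrow> deg_le k (Cst c * p)"
  using keys_Cst_mult[of c p] by (auto simp: deg_le_def)

lemma self_in_line: "p \<in> line p"
  unfolding line_def using Cst_simps(2) by (force intro: exI[of _ 1])

lemma line_eq_iff: "line p = line q \<longleftrightarrow> (\<exists>c. c \<noteq> 0 \<and> q = Cst c * p)"
proof
  assume "line p = line q"
  with self_in_line[of q] show "\<exists>c. c \<noteq> 0 \<and> q = Cst c * p"
    by (auto simp: line_def)
next
  have sub: "line (Cst c * p) \<subseteq> line p" if "c \<noteq> 0" for c and p :: "('a, 'b) mpoly"
  proof
    fix x assume "x \<in> line (Cst c * p)"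
    then obtain e where "e \<noteq> 0" "x = Cst e * (Cst c * p)" by (auto simp: line_def)
    then have "e * c \<noteq> 0" "x = Cst (e * c) * p" using that by (simp_all add: Cst_mult mult.assoc)
    then show "x \<in> line p" by (auto simp: line_def)
  qed
  assume "\<exists>c. c \<noteq> 0 \<and> q = Cst c * p"
  then obtain c where c: "c \<noteq> 0" "q = Cst c * p" by blast
  then have "line q \<subseteq> line p" using sub by blast
  moreover have "line (Cst (inverse c) * q) \<subseteq> line q" by (rule sub) (use c in simp)
  then have "line p \<subseteq> line q" using c by (simp add: Cst_inverse_mult)
  ultimately show "line p = line q" by blast
qed

lemma mu_nonzero_imp_nonzero:
  assumes "mu r B \<Lambda> \<noteq> 0"
  shows "B j \<noteq> 0" "\<Lambda> \<noteq> 0"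
proof -
  show "\<Lambda> \<noteq> 0"
    using mu_scale[of r "\<lambda>_. 1" B 0 0] assms by auto
  show "B j \<noteq> 0"
  proof
    assume "B j = 0"
    then have "(\<lambda>i. Cst (if i = j then 0 else 1) * B i) = B" by auto
    moreover have "(\<Prod>i\<in>UNIV. if i = j then 0 else (1::'b)) = 0"
      by (rule prod_zero) auto
    ultimately show False
      using mu_scale[of r "\<lambda>i. if i = j then 0 else 1" B 1 \<Lambda>] assms by simp
  qed
qed

lemma Y_conditions_iff:
  fixes B :: "('n::finite, 'a::field) pmap"
  assumes "\<And>j. B j \<in> V r j" "\<And>j. deg_le (int (d j)) (B j)" "deg_le (int d\<Lambda>) \<Lambda>"
  shows "((\<forall>e\<in>Y_equations r d d\<Lambda>. insertion of_int (coords B \<Lambda>) e = 0) \<and>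
           insertion of_int (coords B \<Lambda>) (generic_mu r d d\<Lambda> 0) \<noteq> 0 \<and> total_degree \<Lambda> \<ge> 1)
       \<longleftrightarrow> (\<exists>\<kappa>. \<kappa> \<noteq> 0 \<and> mu r B \<Lambda> = Cst \<kappa>) \<and> \<Lambda> \<notin> range Cst"
proof -
  have "(\<forall>e\<in>Y_equations r d d\<Lambda>. insertion of_int (coords B \<Lambda>) e = 0) \<longleftrightarrow>
      (\<forall>b. 1 \<le> mdeg b \<and> int (mdeg b) \<le> deg_bound d d\<Lambda> \<longrightarrow> coeff (mu r B \<Lambda>) b = 0)"
    unfolding Y_equations_def insertion_generic_mu[of B r d d\<Lambda> \<Lambda>, OF assms, symmetric] by blast
  moreover have "insertion of_int (coords B \<Lambda>) (generic_mu r d d\<Lambda> 0) = coeff (mu r B \<Lambda>) 0"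
    by (rule insertion_generic_mu[OF assms])
  moreover have "total_degree \<Lambda> \<ge> 1 \<longleftrightarrow> \<Lambda> \<notin> range Cst"
    by (simp only: in_range_Cst_iff not_not)
  ultimately show ?thesis
    unfolding const_nonzero_iff_coeffs[OF deg_le_mu[OF assms(2,3)]] by (simp only: conj_assoc)
qed

text \<open>
  The membership condition runs over all representatives of the lines; by multihomogeneity of \<open>mu\<close> it
  is enough to look at one of them.
\<close>

lemma Y_points_iff:
  fixes B :: "('n::finite, 'a::field) pmap"
  assumes B: "\<And>j. B j \<in> V r j" "\<And>j. deg_le (int (d j)) (B j)" "deg_le (int d\<Lambda>) \<Lambda>"
    and nz: "\<And>j. B j \<noteq> 0" "\<Lambda> \<noteq> 0"
  shows "((\<lambda>j. line (B j)), line \<Lambda>) \<in> Y_points r d d\<Lambda> \<longleftrightarrow>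
    (\<exists>\<kappa>. \<kappa> \<noteq> 0 \<and> mu r B \<Lambda> = Cst \<kappa>) \<and> \<Lambda> \<notin> range Cst" (is "_ \<longleftrightarrow> ?good B \<Lambda>")
proof -
  have good_scale: "?good B' \<Lambda>'" "\<And>j. B' j \<in> V r j" "\<And>j. deg_le (int (d j)) (B' j)" "deg_le (int d\<Lambda>) \<Lambda>'"
    if good: "?good B \<Lambda>" and rep: "\<And>j. B' j \<in> line (B j)" "\<Lambda>' \<in> line \<Lambda>" for B' \<Lambda>'
  proof -
    obtain c where c: "\<And>j. c j \<noteq> 0" "\<And>j. B' j = Cst (c j) * B j"
      using rep(1) unfolding line_def by simp metis
    obtain e where e: "e \<noteq> 0" "\<Lambda>' = Cst e * \<Lambda>"
      using rep(2) by (auto simp: line_def)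
    have B': "B' = (\<lambda>j. Cst (c j) * B j)" using c by auto
    obtain \<kappa> where "\<kappa> \<noteq> 0" "mu r B \<Lambda> = Cst \<kappa>" using good by blast
    then have "mu r B' \<Lambda>' = Cst (e * (\<Prod>i\<in>UNIV. c i) * \<kappa>)" "e * (\<Prod>i\<in>UNIV. c i) * \<kappa> \<noteq> 0"
      unfolding B' e(2) mu_scale using c e by (simp_all add: Cst_mult)
    moreover have "\<Lambda>' \<notin> range Cst"
    proof
      assume "\<Lambda>' \<in> range Cst"
      then obtain a where "Cst e * \<Lambda> = Cst a" using e by auto
      then have "\<Lambda> = Cst (inverse e * a)"
        using Cst_inverse_mult[of e \<Lambda>] e by (simp add: Cst_mult)
      then show False using good by blast
    qed
    ultimately show "?good B' \<Lambda>'" by blast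
    show "B' j \<in> V r j" "deg_le (int (d j)) (B' j)" "deg_le (int d\<Lambda>) \<Lambda>'" for j
      using B by (simp_all add: c e Cst_mult_in_V deg_le_Cst_mult)
  qed
  have proj: "line (B j) \<in> proj_space {p \<in> V r j. total_degree p \<le> d j}"
      "line \<Lambda> \<in> proj_space {p. total_degree p \<le> d\<Lambda>}" for j
    unfolding proj_space_def total_degree_le_iff using B nz by auto
  show ?thesis
  proof
    assume "((\<lambda>j. line (B j)), line \<Lambda>) \<in> Y_points r d d\<Lambda>"
    then show "?good B \<Lambda>"
      using self_in_line unfolding Y_conditions_iff[OF B, symmetric] Y_points_def by blast
  next
    assume good: "?good B \<Lambda>"
    show "((\<lambda>j. line (B j)), line \<Lambda>) \<in> Y_points r d d\<Lambda>"
      unfolding Y_points_def mem_Collect_eq prod.case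
    proof (intro conjI allI impI[where P = "_ \<and> _"])
      fix B' \<Lambda>' assume "(\<forall>j. B' j \<in> line (B j)) \<and> \<Lambda>' \<in> line \<Lambda>"
      then have rep: "\<And>j. B' j \<in> line (B j)" "\<Lambda>' \<in> line \<Lambda>" by auto
      note sc = good_scale[OF good rep]
      from sc(1) show "\<forall>e\<in>Y_equations r d d\<Lambda>. insertion of_int (coords B' \<Lambda>') e = 0"
        "insertion of_int (coords B' \<Lambda>') (generic_mu r d d\<Lambda> 0) \<noteq> 0" "1 \<le> total_degree \<Lambda>'"
        unfolding Y_conditions_iff[OF sc(2-4), symmetric] by blast+
    qed (rule proj)+
  qed
qed

lemma graded_form_determines_map:
  assumes "graded_form r G \<Lambda> B" "graded_form r G' \<Lambda> B"
  shows "G = G'"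
proof
  fix v show "G v = G' v"
  proof (cases v)
    case None then show ?thesis using assms by (simp add: graded_form_def)
  next
    case (Some j)
    have "Var None ^ r j * G (Some j) = Var None ^ r j * G' (Some j)"
      using assms by (simp add: graded_form_def)
    then show ?thesis unfolding Some by (rule Var_power_cancel)
  qed
qed

lemma graded_form_rescale:
  assumes "graded_form r G \<Lambda> B"
  shows "graded_form r (\<lambda>v. Cst (c v) * G v) (Cst (c None) * \<Lambda>) (\<lambda>j. Cst (c (Some j)) * B j)"
  using assms by (simp add: graded_form_def Cst_mult_in_V psubst.hom_mult mult.left_commute)

text \<open>
  Multiplying components of \<open>G\<close> by constants multiplies \<open>\<Lambda>\<close> and the \<open>B\<^sub>j\<close> by the same constants, and
  each of \<open>G\<close> and \<open>(\<Lambda>, B)\<close> determines the other.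
\<close>

lemma rescaling_iff_lines:
  assumes gf: "graded_form r G \<Lambda> B" and gf': "graded_form r G' \<Lambda>' B'"
  shows "(G, G') \<in> rescaling \<longleftrightarrow> (\<lambda>j. line (B j)) = (\<lambda>j. line (B' j)) \<and> line \<Lambda> = line \<Lambda>'"
proof
  assume "(G, G') \<in> rescaling"
  then obtain c where c: "\<And>v. c v \<noteq> 0" "\<And>v. G' v = Cst (c v) * G v"
    unfolding rescaling_def by (simp) metis
  then have G': "G' = (\<lambda>v. Cst (c v) * G v)" by auto
  from graded_form_unique[OF graded_form_rescale[OF gf, of c] gf'[unfolded G']]
  show "(\<lambda>j. line (B j)) = (\<lambda>j. line (B' j)) \<and> line \<Lambda> = line \<Lambda>'"
    using c(1) by (auto simp: fun_eq_iff line_eq_iff)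
next
  assume "(\<lambda>j. line (B j)) = (\<lambda>j. line (B' j)) \<and> line \<Lambda> = line \<Lambda>'"
  then have "\<forall>j. \<exists>c. c \<noteq> 0 \<and> B' j = Cst c * B j" "\<exists>e. e \<noteq> 0 \<and> \<Lambda>' = Cst e * \<Lambda>"
    by (simp_all add: fun_eq_iff line_eq_iff)
  then obtain c e where c: "\<And>j. c j \<noteq> 0" "\<And>j. B' j = Cst (c j) * B j" and e: "e \<noteq> 0" "\<Lambda>' = Cst e * \<Lambda>"
    by metis
  have "B' = (\<lambda>j. Cst (c j) * B j)" using c by auto
  then have "graded_form r (\<lambda>v. Cst (case_option e c v) * G v) \<Lambda>' B'"
    using graded_form_rescale[OF gf, of "case_option e c"] by (simp add: e)
  then have "G' = (\<lambda>v. Cst (case_option e c v) * G v)"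
    by (rule graded_form_determines_map[OF gf'])
  moreover have "case_option e c v \<noteq> 0" for v
    using c e by (cases v) auto
  ultimately show "(G, G') \<in> rescaling"
    unfolding rescaling_def by auto
qed

lemma equiv_rescaling: "equiv UNIV (rescaling :: (('v, complex) pmap \<times> ('v, complex) pmap) set)"
  (is "equiv UNIV ?R")
proof (rule equivI)
  show "refl ?R"
    unfolding refl_on_def rescaling_def by (auto intro!: exI[of _ 1])
  show "sym ?R"
  proof (rule symI)
    fix G G' :: "('v, complex) pmap" assume "(G, G') \<in> rescaling"
    then have "\<forall>v. \<exists>c. c \<noteq> 0 \<and> G' v = Cst c * G v" by (simp add: rescaling_def)
    then have "\<forall>v. \<exists>c. c \<noteq> 0 \<and> G v = Cst c * G' v"
      by (metis Cst_inverse_mult inverse_nonzero_iff_nonzero)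
    then show "(G', G) \<in> rescaling" by (simp add: rescaling_def)
  qed
  show "trans ?R"
  proof (rule transI)
    fix G G' G'' :: "('v, complex) pmap"
    assume "(G, G') \<in> rescaling" "(G', G'') \<in> rescaling"
    then have "\<forall>v. \<exists>c. c \<noteq> 0 \<and> G' v = Cst c * G v" "\<forall>v. \<exists>c. c \<noteq> 0 \<and> G'' v = Cst c * G' v"
      by (simp_all add: rescaling_def)
    then have "\<forall>v. \<exists>c. c \<noteq> 0 \<and> G'' v = Cst c * G v"
      by (metis Cst_mult mult.assoc no_zero_divisors)
    then show "(G, G'') \<in> rescaling" by (simp add: rescaling_def)
  qed
qed auto

lemma graded_counterexample_criterion:
  assumes "graded_form r G \<Lambda> B" "\<exists>\<kappa>. \<kappa> \<noteq> 0 \<and> mu r B \<Lambda> = Cst \<kappa>" "\<Lambda> \<notin> range Cst"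
  shows "jc_counterexample G"
  using assms graded_form_not_automorphism keller_graded_form
  unfolding jc_counterexample_def by blast

text \<open>
  The two existential quantifiers in the definition of the family may concern different pairs
  \<open>(\<Lambda>, B)\<close>; uniqueness of the pair identifies them.
\<close>

lemma nonconst_graded_counterexamples_iff:
  assumes gf: "graded_form r G \<Lambda> B"
  shows "G \<in> nonconst_graded_counterexamples r d d\<Lambda> \<longleftrightarrow>
    deg_le (int d\<Lambda>) \<Lambda> \<and> (\<forall>j. deg_le (int (d j)) (B j)) \<and>
    (\<exists>\<kappa>. \<kappa> \<noteq> 0 \<and> mu r B \<Lambda> = Cst \<kappa>) \<and> \<Lambda> \<notin> range Cst"
proof -
  have ex: "(\<exists>\<Lambda> B. graded_form r G \<Lambda> B \<and> P \<Lambda> B) \<longleftrightarrow> P \<Lambda> B" for P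
    using gf graded_form_unique[OF gf] by metis
  have "jc_counterexample G \<and> \<Lambda> \<notin> range Cst \<longleftrightarrow> (\<exists>\<kappa>. \<kappa> \<noteq> 0 \<and> mu r B \<Lambda> = Cst \<kappa>) \<and> \<Lambda> \<notin> range Cst"
    using graded_counterexample_criterion[OF gf] keller_graded_form[OF gf]
    unfolding jc_counterexample_def by blast
  then show ?thesis
    unfolding nonconst_graded_counterexamples_def graded_counterexamples_def mem_Collect_eq ex total_degree_le_iff
    using graded_form_imp_graded_map[OF gf] by blast
qed

text \<open>
  The map sends a class to the lines spanned by \<open>\<Lambda>\<close> and the \<open>B\<^sub>j\<close>. It is well defined and injective by
  \<open>rescaling_iff_lines\<close>; its image is the set of points because, for nonconstant \<open>\<Lambda>\<close>, being a
  counterexample and satisfying the equations both mean that \<open>mu\<close> is a nonzero constant.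
\<close>

lemma Y_points_parametrise:
  "\<exists>\<Phi>. bij_betw \<Phi> (nonconst_graded_counterexamples r d d\<Lambda> // rescaling) (Y_points r d d\<Lambda>) \<and>
     (\<forall>G \<Lambda> B. G \<in> nonconst_graded_counterexamples r d d\<Lambda> \<and> graded_form r G \<Lambda> B
        \<longrightarrow> \<Phi> (rescaling `` {G}) = ((\<lambda>j. line (B j)), line \<Lambda>))"
proof -
  let ?N = "nonconst_graded_counterexamples r d d\<Lambda>"
  let ?cls = "\<lambda>G. rescaling `` {G}"
  define \<psi> where "\<psi> G = ((\<lambda>j. line (dehom (G (Some j)))), line (dehom (G None)))"
    for G :: "('a option, complex) pmap"
  define \<Phi> where "\<Phi> C = \<psi> (SOME G. G \<in> ?N \<and> C = ?cls G)" for C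
  have gf_N: "graded_form r G (dehom (G None)) (\<lambda>j. dehom (G (Some j)))" if "G \<in> ?N" for G
    by (rule graded_map_imp_graded_form)
       (use that in \<open>simp add: nonconst_graded_counterexamples_def graded_counterexamples_def\<close>)
  have cls_eq: "?cls G = ?cls G' \<longleftrightarrow> \<psi> G = \<psi> G'" if "G \<in> ?N" "G' \<in> ?N" for G G'
    using rescaling_iff_lines[OF gf_N[OF that(1)] gf_N[OF that(2)]]
    by (simp add: eq_equiv_class_iff[OF equiv_rescaling] \<psi>_def)
  have \<Phi>_cls: "\<Phi> (?cls G) = \<psi> G" if G: "G \<in> ?N" for G
  proof -
    define G' where "G' = (SOME G'. G' \<in> ?N \<and> ?cls G = ?cls G')"
    have "G' \<in> ?N \<and> ?cls G = ?cls G'"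
      unfolding G'_def by (rule someI[of _ G]) (use G in simp)
    then have "\<psi> G = \<psi> G'"
      using cls_eq[OF G] by blast
    then show ?thesis by (simp add: \<Phi>_def G'_def)
  qed
  \<comment> \<open>The representative read off at \<open>x = 1\<close> is the only one.\<close>
  have \<psi>_eq: "\<psi> G = ((\<lambda>j. line (B j)), line \<Lambda>)" if "G \<in> ?N" "graded_form r G \<Lambda> B" for G \<Lambda> B
    using graded_form_unique[OF that(2) gf_N[OF that(1)]] by (simp add: \<psi>_def fun_eq_iff)
  have "\<psi> ` ?N = Y_points r d d\<Lambda>"
  proof (intro equalityI subsetI)
    fix y assume "y \<in> \<psi> ` ?N"
    then obtain G where G: "G \<in> ?N" "y = \<psi> G" by blast
    note gf = gf_N[OF G(1)]
    note N = G(1)[unfolded nonconst_graded_counterexamples_iff[OF gf]]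
    then have "mu r (\<lambda>j. dehom (G (Some j))) (dehom (G None)) \<noteq> 0"
      by (metis Cst_eq_iff Cst_simps(1))
    note nz = mu_nonzero_imp_nonzero[OF this]
    have "dehom (G (Some j)) \<in> V r j" for j using gf by (simp add: graded_form_def)
    then show "y \<in> Y_points r d d\<Lambda>"
      unfolding G(2) \<psi>_def by (subst Y_points_iff) (use N nz in auto)
  next
    fix y :: "('a \<Rightarrow> ('a, complex) mpoly set) \<times> ('a, complex) mpoly set"
    assume y: "y \<in> Y_points r d d\<Lambda>"
    obtain L M where LM: "y = (L, M)" by (cases y)
    with y have "\<forall>j. L j \<in> proj_space {p \<in> V r j. total_degree p \<le> d j}"
        "M \<in> proj_space {p. total_degree p \<le> d\<Lambda>}"
      by (auto simp: Y_points_def)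
    then have "\<forall>j. \<exists>p. L j = line p \<and> p \<noteq> 0 \<and> p \<in> V r j \<and> deg_le (int (d j)) p"
        "\<exists>p. M = line p \<and> p \<noteq> 0 \<and> deg_le (int d\<Lambda>) p"
      unfolding proj_space_def total_degree_le_iff by blast+
    then obtain B \<Lambda> where B: "\<And>j. L j = line (B j)" "\<And>j. B j \<noteq> 0" "\<And>j. B j \<in> V r j"
        "\<And>j. deg_le (int (d j)) (B j)"
      and \<Lambda>: "M = line \<Lambda>" "\<Lambda> \<noteq> 0" "deg_le (int d\<Lambda>) \<Lambda>"
      by metis
    have y': "y = ((\<lambda>j. line (B j)), line \<Lambda>)" using LM B \<Lambda> by auto
    obtain G where gf: "graded_form r G \<Lambda> B" using graded_form_exists[OF B(3)] by blast
    have "G \<in> ?N"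
      using y Y_points_iff[OF B(3,4) \<Lambda>(3) B(2) \<Lambda>(2)] B(4) \<Lambda>(3)
      unfolding y' nonconst_graded_counterexamples_iff[OF gf] by blast
    then have "y = \<psi> G" using \<psi>_eq[OF _ gf] y' by simp
    then show "y \<in> \<psi> ` ?N" using \<open>G \<in> ?N\<close> by (rule image_eqI)
  qed
  moreover have "?N // rescaling = ?cls ` ?N" by (auto simp: quotient_def)
  ultimately have "bij_betw \<Phi> (?N // rescaling) (Y_points r d d\<Lambda>)"
    by (auto simp: bij_betw_def inj_on_def image_image \<Phi>_cls cls_eq)
  then show ?thesis using \<Phi>_cls \<psi>_eq by auto
qed

section \<open>Vasyunin's map\<close>

lemma peval_Cst [simp]: "peval a (Cst c) = c"
  unfolding peval_def by (rule semiring_hom.insertion_Cst[OF semiring_hom_ident])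

lemma graded_map_vasyunin: "graded_map (weight vasyunin_r) (weight vasyunin_r) vasyunin"
  unfolding graded_map_def
proof
  fix v :: "4 option"
  let ?w = "weight vasyunin_r"
  let ?H = "weighted_homogeneous ?w"
  have X: "?H 1 (Var None :: (_, complex) mpoly)" "?H (- 1) (Var (Some 1) :: (_, complex) mpoly)"
    "?H (- 2) (Var (Some 2) :: (_, complex) mpoly)" "?H (- 3) (Var (Some 3) :: (_, complex) mpoly)"
    "?H (- 4) (Var (Some 4) :: (_, complex) mpoly)"
    using weighted_homogeneous_Var[of ?w None] weighted_homogeneous_Var[of ?w "Some 1"]
      weighted_homogeneous_Var[of ?w "Some 2"] weighted_homogeneous_Var[of ?w "Some 3"]
      weighted_homogeneous_Var[of ?w "Some 4"]
    by (simp_all add: weight_def vasyunin_r_def)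
  have half: "?H k p \<Longrightarrow> ?H k (Cst (1/2) * p)" for k and p :: "(4 option, complex) mpoly"
    using weighted_homogeneous_mult[OF weighted_homogeneous_Cst, of ?w k p] by simp
  note XX = weighted_homogeneous_mult[OF X(1) X(3)] weighted_homogeneous_mult[OF X(1) X(4)]
    weighted_homogeneous_mult[OF X(1) X(5)] weighted_homogeneous_mult[OF X(2) X(3)]
    half[OF weighted_homogeneous_power[OF X(2), of 2]] half[OF weighted_homogeneous_power[OF X(3), of 2]]
  consider "v = None" | "v = Some 1" | "v = Some 2" | "v = Some 3" | "v = Some 4"
    by (cases v) (use exhaust_4 in auto)
  then show "?H (?w v) (vasyunin v)"
    using X XX
    by cases (simp_all add: vasyunin_def weight_def vasyunin_r_def weighted_homogeneous_add weighted_homogeneous_diff)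
qed

lemma dehom_vasyunin:
  fixes u :: "4 \<Rightarrow> (4, complex) mpoly"
  defines "u \<equiv> Var"
  shows "dehom (vasyunin None) = 1"
    "dehom (vasyunin (Some i)) = (if i = 1 then u 1 + u 2 else if i = 2 then u 2 + u 3 + Cst (1/2) * u 1 ^ 2
       else if i = 3 then u 3 + u 4 - u 1 * u 2 else u 4 + Cst (1/2) * u 2 ^ 2)"
proof -
  have minus: "psubst f (p - q) = psubst f p - psubst f q"
    for f :: "4 option \<Rightarrow> (4, complex) mpoly" and p q :: "(4 option, complex) mpoly"
    using psubst.hom_add[of f p "- q"] by (simp add: psubst.hom_uminus)
  show "dehom (vasyunin None) = 1"
    by (simp add: vasyunin_def dehom_def)
  show "dehom (vasyunin (Some i)) = (if i = 1 then u 1 + u 2 else if i = 2 then u 2 + u 3 + Cst (1/2) * u 1 ^ 2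
       else if i = 3 then u 3 + u 4 - u 1 * u 2 else u 4 + Cst (1/2) * u 2 ^ 2)"
    using exhaust_4[of i]
    by (auto simp: vasyunin_def u_def dehom_def minus psubst.hom_add psubst.hom_mult psubst.hom_power)
qed

text \<open>
  Since \<open>\<Lambda> = 1\<close> has zero gradient, only the Jacobian of \<open>B\<close> remains in \<open>mu\<close>.
\<close>

lemma mu_vasyunin: "mu vasyunin_r (\<lambda>j. dehom (vasyunin (Some j))) 1 = 1"
proof -
  let ?B = "\<lambda>j. dehom (vasyunin (Some j))"
  have "jac (?B(i := 1)) = 0" for i
    unfolding jac_def by (rule det_zero_row_ring[of _ i]) simp
  moreover have "jac ?B = 1"
  proof -
    have half: "Cst (1/2) * (2 * p) = p" for p :: "(4, complex) mpoly"
    proof -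
      have "Cst (1/2) * (2 * p) = Cst (1/2) * Cst 2 * p" by (simp add: Cst_def)
      then show ?thesis by (simp flip: Cst_mult)
    qed
    have minus: "partial_deriv v (p - q) = partial_deriv v p - partial_deriv v q" for v and p q :: "(4, complex) mpoly"
      using partial_deriv_add[of v "p - q" q] by simp
    show ?thesis
      unfolding jac_def det_4
      by (simp add: dehom_vasyunin partial_deriv_add minus partial_deriv_mult partial_deriv_power
          partial_deriv_Var half)
  qed
  ultimately show ?thesis by (simp add: mu_def)
qed

section \<open>Graded Keller maps\<close>

theorem proposition10p3:
  fixes r d :: "'n::finite \<Rightarrow> nat" and d\<Lambda> :: nat
  assumes "CARD('n) + 1 \<ge> 3"
  shows
    "(\<forall>G. graded_map (weight r) (weight r) G \<longleftrightarrow> (\<exists>!(\<Lambda>B). graded_form r G (fst \<Lambda>B) (snd \<Lambda>B))) \<and>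
     ((\<Sum>i\<in>UNIV. r i) \<ge> 2 \<longrightarrow>
        (\<forall>G \<Lambda> B. graded_form r G \<Lambda> B \<and> (\<exists>\<kappa>. \<kappa> \<noteq> 0 \<and> mu r B \<Lambda> = Cst \<kappa>) \<and> \<Lambda> \<notin> range Cst
           \<longrightarrow> jc_counterexample G) \<and>
        (\<exists>\<Phi>. bij_betw \<Phi> (nonconst_graded_counterexamples r d d\<Lambda> // rescaling) (Y_points r d d\<Lambda>) \<and>
           (\<forall>G \<Lambda> B. G \<in> nonconst_graded_counterexamples r d d\<Lambda> \<and> graded_form r G \<Lambda> B
              \<longrightarrow> \<Phi> (rescaling `` {G}) = ((\<lambda>j. line (B j)), line \<Lambda>)))) \<and>
     (\<exists>\<epsilon>\<in>{1, -1 :: complex}.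
        ((\<Sum>i\<in>UNIV. r i) \<ge> 1 \<longrightarrow>
          (\<forall>G \<Lambda> B. graded_form r G \<Lambda> B \<longrightarrow>
             jac G * psubst (uvar r) \<Lambda> ^ ((\<Sum>i\<in>UNIV. r i) - 1)
               = Cst \<epsilon> * psubst (uvar r) (jac (Gbar r \<Lambda> B)))) \<and>
        ((\<Sum>i\<in>UNIV. r i) = 1 \<longleftrightarrow> (\<exists>i. r i = 1 \<and> (\<forall>j. j \<noteq> i \<longrightarrow> r j = 0))) \<and>
        ((\<Sum>i\<in>UNIV. r i) = 1 \<longrightarrow>
          (\<Sum>i\<in>UNIV. r i) - 1 = 0 \<and>
          (\<forall>G \<Lambda> B. graded_form r G \<Lambda> B \<longrightarrow>
             jac G = Cst \<epsilon> * psubst (uvar r) (jac (Gbar r \<Lambda> B)) \<and>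
             (\<forall>\<kappa>. jac G = Cst \<kappa> \<longleftrightarrow> jac (Gbar r \<Lambda> B) = Cst (\<epsilon> * \<kappa>)) \<and>
             (keller G \<longleftrightarrow> keller (Gbar r \<Lambda> B)) \<and>
             (keller G \<longrightarrow>
                {a \<in> contracted_locus \<Lambda>. peval a (jac (Gbar r \<Lambda> B)) = 0} = {})))) \<and>
     (graded_map (weight vasyunin_r) (weight vasyunin_r) vasyunin \<and> keller vasyunin \<and>
      (\<exists>B. graded_form vasyunin_r vasyunin 1 B) \<and> contracted_locus (1 :: (4, complex) mpoly) = {})"
proof (intro conjI)
  show "\<forall>G. graded_map (weight r) (weight r) G \<longleftrightarrow> (\<exists>!(\<Lambda>B). graded_form r G (fst \<Lambda>B) (snd \<Lambda>B))"
    by (intro allI graded_map_iff_ex1_graded_form)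
next
  show "(\<Sum>i\<in>UNIV. r i) \<ge> 2 \<longrightarrow>
        (\<forall>G \<Lambda> B. graded_form r G \<Lambda> B \<and> (\<exists>\<kappa>. \<kappa> \<noteq> 0 \<and> mu r B \<Lambda> = Cst \<kappa>) \<and> \<Lambda> \<notin> range Cst
           \<longrightarrow> jc_counterexample G) \<and>
        (\<exists>\<Phi>. bij_betw \<Phi> (nonconst_graded_counterexamples r d d\<Lambda> // rescaling) (Y_points r d d\<Lambda>) \<and>
           (\<forall>G \<Lambda> B. G \<in> nonconst_graded_counterexamples r d d\<Lambda> \<and> graded_form r G \<Lambda> B
              \<longrightarrow> \<Phi> (rescaling `` {G}) = ((\<lambda>j. line (B j)), line \<Lambda>)))"
    by (intro impI conjI allI Y_points_parametrise) (elim conjE, rule graded_counterexample_criterion)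
next
  let ?m = "\<Sum>i\<in>UNIV. r i"
  let ?\<phi> = "psubst (uvar r) :: ('n, complex) mpoly \<Rightarrow> _"
  have jac_G: "jac G * ?\<phi> \<Lambda> ^ (?m - 1) = ?\<phi> (jac (Gbar r \<Lambda> B))"
    if "?m \<ge> 1" "graded_form r G \<Lambda> B" for G \<Lambda> B
    by (simp add: jac_graded_form[OF that(2)] jac_Gbar[OF that(1)] psubst.hom_mult psubst.hom_power)
  show "\<exists>\<epsilon>\<in>{1, -1 :: complex}.
        (?m \<ge> 1 \<longrightarrow>
          (\<forall>G \<Lambda> B. graded_form r G \<Lambda> B \<longrightarrow>
             jac G * ?\<phi> \<Lambda> ^ (?m - 1) = Cst \<epsilon> * ?\<phi> (jac (Gbar r \<Lambda> B)))) \<and>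
        (?m = 1 \<longleftrightarrow> (\<exists>i. r i = 1 \<and> (\<forall>j. j \<noteq> i \<longrightarrow> r j = 0))) \<and>
        (?m = 1 \<longrightarrow>
          ?m - 1 = 0 \<and>
          (\<forall>G \<Lambda> B. graded_form r G \<Lambda> B \<longrightarrow>
             jac G = Cst \<epsilon> * ?\<phi> (jac (Gbar r \<Lambda> B)) \<and>
             (\<forall>\<kappa>. jac G = Cst \<kappa> \<longleftrightarrow> jac (Gbar r \<Lambda> B) = Cst (\<epsilon> * \<kappa>)) \<and>
             (keller G \<longleftrightarrow> keller (Gbar r \<Lambda> B)) \<and>
             (keller G \<longrightarrow>
                {a \<in> contracted_locus \<Lambda>. peval a (jac (Gbar r \<Lambda> B)) = 0} = {})))"
  proof (rule bexI[of _ 1], intro conjI impI allI)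
    fix G \<Lambda> B assume m: "?m \<ge> 1" and gf: "graded_form r G \<Lambda> B"
    show "jac G * ?\<phi> \<Lambda> ^ (?m - 1) = Cst 1 * ?\<phi> (jac (Gbar r \<Lambda> B))"
      using jac_G[OF m gf] by simp
  next
    show "?m = 1 \<longleftrightarrow> (\<exists>i. r i = 1 \<and> (\<forall>j. j \<noteq> i \<longrightarrow> r j = 0))"
      using sum_eq_1_iff[of "UNIV :: 'n set" r] by auto
  next
    assume m: "?m = 1"
    then show "?m - 1 = 0" by simp
    fix G \<Lambda> B assume gf: "graded_form r G \<Lambda> B"
    have jac: "jac G = ?\<phi> (jac (Gbar r \<Lambda> B))"
      using jac_G[OF _ gf] m by simp
    then show "jac G = Cst 1 * ?\<phi> (jac (Gbar r \<Lambda> B))" by simp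
    have const: "jac G = Cst \<kappa> \<longleftrightarrow> jac (Gbar r \<Lambda> B) = Cst \<kappa>" for \<kappa>
      unfolding jac by (metis psubst_uvar_inject psubst_Cst)
    then show "jac G = Cst \<kappa> \<longleftrightarrow> jac (Gbar r \<Lambda> B) = Cst (1 * \<kappa>)" for \<kappa> by simp
    show keller: "keller G \<longleftrightarrow> keller (Gbar r \<Lambda> B)"
      by (simp add: keller_def const)
    show "{a \<in> contracted_locus \<Lambda>. peval a (jac (Gbar r \<Lambda> B)) = 0} = {}" if "keller G"
      using that unfolding keller_def const by auto
  qed simp
next
  show "graded_map (weight vasyunin_r) (weight vasyunin_r) vasyunin"
    by (rule graded_map_vasyunin)
  have gf: "graded_form vasyunin_r vasyunin 1 (\<lambda>j. dehom (vasyunin (Some j)))"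
    using graded_map_imp_graded_form[OF graded_map_vasyunin] by (simp add: dehom_vasyunin(1))
  then show "\<exists>B. graded_form vasyunin_r vasyunin 1 B" by blast
  have "mu vasyunin_r (\<lambda>j. dehom (vasyunin (Some j))) 1 = Cst 1"
    by (simp add: mu_vasyunin)
  then show "keller vasyunin"
    unfolding keller_graded_form[OF gf] using one_neq_zero by blast
  show "contracted_locus (1 :: (4, complex) mpoly) = {}"
  proof -
    have "peval a (1 :: (4, complex) mpoly) = 1" for a
      using peval_Cst[of a 1] by simp
    then show ?thesis by (simp add: contracted_locus_def)
  qed
qed

end
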